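(* Let $0<p<1$, let $S\in\mathbb{N}$, and let $r>1$ satisfy $$r>\frac{1}{1/p-1}.$$ Then the $L_\infty$-recovery of an unknown ridge function from the classes $R_d^{r,(p,S)}$, $d>S$ (that is, $S\in\{1,\dots,d-1\}$), is (at least) weakly tractable, i.e. $$\lim_{\varepsilon^{-1}+d\to\infty}\frac{\log n(\varepsilon,R_d^{r,(p,S)})}{\varepsilon^{-1}+d}=0 .$$
   Context: $\|a\|_p=(\sum_{i=1}^d|a_i|^p)^{1/p}$. For $r>0$ let $m$ be the largest integer strictly less than $r$ and $\beta=r-m\in(0,1]$. $B^{\mathrm{Lip}(r)}$ is the set of all $m$ times continuously differentiable $g:[-1,1]\to\mathbb{R}$ with $\max\{\|g\|_\infty,\|g^{(1)}\|_\infty,\dots,\|g^{(m)}\|_\infty,|g^{(m)}|_\beta\}\le 1$, where $|g^{(m)}|_\beta=\sup_{u\ne v\in[-1,1]}\frac{|g^{(m)}(u)-g^{(m)}(v)|}{2\min\{1,|u-v|\}^\beta}$. $R_d^{r,(p,S)}$ is the set of $f:[-1,1]^d\to\mathbb{R}$, $f(x)=g(a^{T}x)$ with $g\in B^{\mathrm{Lip}(r)}$ and $a\in\mathbb{R}^d$ satisfying $\|a\|_p\le 1$ and $\|a\|_1\ge\min\{1,4S^{1-1/p}\}$. For a class $F_d\subset C([-1,1]^d)$, a deterministic algorithm using at most $n$ function values is a map $S_n:F_d\to C([-1,1]^d)$ of the form $S_n(f)=\phi(f(x_1),\dots,f(x_n))$ with an arbitrary map $\phi:\mathbb{R}^n\to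 C([-1,1]^d)$, where $x_1\in[-1,1]^d$ is fixed (independent of $f$) and $x_i=\psi_i(f(x_1),\dots,f(x_{i-1}))$ for $i=2,\dots,n$ with arbitrary maps $\psi_i:\mathbb{R}^{i-1}\to[-1,1]^d$. Put $\mathrm{err}(n,F_d)=\inf_{S_n}\sup_{f\in F_d}\|f-S_n(f)\|_\infty$ (infimum over all such algorithms) and $n(\varepsilon,F_d)=\min\{n\in\mathbb{N}:\mathrm{err}(n,F_d)\le\varepsilon\}$ for $\varepsilon>0$. *)

theory Defs
  imports "HOL-Analysis.Analysis"
begin

text \<open>Suprema and infima of real quantities are taken in \<open>ereal\<close>, so that unbounded families
  have value \<open>\<infinity>\<close>.\<close>

definition sup_norm_on :: "'a set \<Rightarrow> ('a \<Rightarrow> real) \<Rightarrow> ereal" where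
  "sup_norm_on X h = (SUP x\<in>X. ereal \<bar>h x\<bar>)"

text \<open>The derivatives are relative to \<open>[-1,1]\<close>, hence one-sided at the end points.\<close>

definition nth_deriv :: "nat \<Rightarrow> (real \<Rightarrow> real) \<Rightarrow> real \<Rightarrow> real" where
  "nth_deriv k g = ((\<lambda>h x. vector_derivative h (at x within {-1..1})) ^^ k) g"

definition times_cont_diff :: "nat \<Rightarrow> (real \<Rightarrow> real) \<Rightarrow> bool" where
  "times_cont_diff m g \<longleftrightarrow>
     (\<forall>k<m. nth_deriv k g differentiable_on {-1..1}) \<and> continuous_on {-1..1} (nth_deriv m g)"

definition holder_seminorm :: "real \<Rightarrow> (real \<Rightarrow> real) \<Rightarrow> ereal" where
  "holder_seminorm \<beta> h =
     (SUP (u, v) \<in> {(u, v). u \<in> {-1..1} \<and> v \<in> {-1..1} \<and> u \<noteq> v}.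
        ereal (\<bar>h u - h v\<bar> / (2 * min 1 \<bar>u - v\<bar> powr \<beta>)))"

text \<open>For \<open>r > 0\<close> this is the largest integer strictly less than \<open>r\<close>; so it is \<open>r - 1\<close>,
  not \<open>r\<close>, if \<open>r\<close> is an integer.\<close>

definition smooth_order :: "real \<Rightarrow> nat" where
  "smooth_order r = nat (\<lceil>r\<rceil> - 1)"

definition lip_ball :: "real \<Rightarrow> (real \<Rightarrow> real) set" where
  "lip_ball r = {g. times_cont_diff (smooth_order r) g \<and>
     (\<forall>k\<le>smooth_order r. sup_norm_on {-1..1} (nth_deriv k g) \<le> 1) \<and>
     holder_seminorm (r - real (smooth_order r)) (nth_deriv (smooth_order r) g) \<le> 1}"

text \<open>Since the dimension \<open>d\<close> varies, vectors of length \<open>d\<close> are functions \<open>nat \<Rightarrow> real\<close> of which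
  only the coordinates \<open>i < d\<close> matter. Points of the cube are \<open>undefined\<close> at the other
  coordinates, so the product topology on \<open>nat \<Rightarrow> real\<close> induces the Euclidean topology on the
  cube.\<close>

definition cube :: "nat \<Rightarrow> (nat \<Rightarrow> real) set" where
  "cube d = ({..<d} \<rightarrow>\<^sub>E {-1..1})"

definition lp_norm :: "nat \<Rightarrow> real \<Rightarrow> (nat \<Rightarrow> real) \<Rightarrow> real" where
  "lp_norm d p a = (\<Sum>i<d. \<bar>a i\<bar> powr p) powr (1 / p)"

definition cont_funs :: "nat \<Rightarrow> ((nat \<Rightarrow> real) \<Rightarrow> real) set" where
  "cont_funs d = {h \<in> extensional (cube d). continuous_on (cube d) h}"

definition ridge_class :: "real \<Rightarrow> real \<Rightarrow> nat \<Rightarrow> nat \<Rightarrow> ((nat \<Rightarrow> real) \<Rightarrow> real) set" where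
  "ridge_class r p S d = {restrict (\<lambda>x. g (\<Sum>i<d. a i * x i)) (cube d) | g a.
     g \<in> lip_ball r \<and> lp_norm d p a \<le> 1 \<and>
     lp_norm d 1 a \<ge> min 1 (4 * real S powr (1 - 1 / p))}"

text \<open>The list of the first \<open>n\<close> observed values of \<open>f\<close>: the next node is obtained by applying
  \<open>\<psi>\<close> to the list of values observed so far. The first node \<open>\<psi> []\<close> does not depend on \<open>f\<close>, and
  \<open>\<psi>\<close> restricted to lists of length \<open>i\<close> chooses node number \<open>i + 1\<close>.\<close>

primrec observations ::
    "(real list \<Rightarrow> nat \<Rightarrow> real) \<Rightarrow> ((nat \<Rightarrow> real) \<Rightarrow> real) \<Rightarrow> nat \<Rightarrow> real list" where
  "observations \<psi> f 0 = []"
| "observations \<psi> f (Suc n) = observations \<psi> f n @ [f (\<psi> (observations \<psi> f n))]"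

definition sampling_algorithms ::
    "nat \<Rightarrow> nat \<Rightarrow> ((nat \<Rightarrow> real) \<Rightarrow> real) set \<Rightarrow>
     (((nat \<Rightarrow> real) \<Rightarrow> real) \<Rightarrow> (nat \<Rightarrow> real) \<Rightarrow> real) set" where
  "sampling_algorithms n d F = {A. \<exists>\<psi> \<phi>.
     (\<forall>ys. length ys < n \<longrightarrow> \<psi> ys \<in> cube d) \<and>
     (\<forall>ys. length ys = n \<longrightarrow> \<phi> ys \<in> cont_funs d) \<and>
     (\<forall>f\<in>F. A f = \<phi> (observations \<psi> f n))}"

definition err :: "nat \<Rightarrow> nat \<Rightarrow> ((nat \<Rightarrow> real) \<Rightarrow> real) set \<Rightarrow> ereal" where
  "err n d F = (INF A \<in> sampling_algorithms n d F. SUP f\<in>F.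
     sup_norm_on (cube d) (\<lambda>x. f x - A f x))"

text \<open>The natural numbers start at \<open>1\<close> here, which keeps the logarithm meaningful. The \<open>LEAST\<close> is
  the minimum only if the predicate is satisfiable.\<close>

definition info_complexity :: "real \<Rightarrow> nat \<Rightarrow> ((nat \<Rightarrow> real) \<Rightarrow> real) set \<Rightarrow> nat" where
  "info_complexity \<epsilon> d F = (LEAST n. 1 \<le> n \<and> err n d F \<le> ereal \<epsilon>)"

text \<open>The first conjunct says that \<open>info_complexity\<close> is indeed a minimum. The second is the limit
  along all pairs \<open>(\<epsilon>, d)\<close> with \<open>\<epsilon> > 0\<close> and \<open>d \<in> D\<close> as \<open>1/\<epsilon> + d\<close> tends to infinity.\<close>

definition weakly_tractable :: "nat set \<Rightarrow> (nat \<Rightarrow> ((nat \<Rightarrow> real) \<Rightarrow> real) set) \<Rightarrow> bool" where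
  "weakly_tractable D F \<longleftrightarrow>
     (\<forall>\<epsilon>>0. \<forall>d\<in>D. \<exists>n\<ge>1. err n d (F d) \<le> ereal \<epsilon>) \<and>
     ((\<lambda>(\<epsilon>, d). ln (real (info_complexity \<epsilon> d (F d))) / (1 / \<epsilon> + real d)) \<longlongrightarrow> 0)
       (inf (filtercomap (\<lambda>(\<epsilon>, d). 1 / \<epsilon> + real d) at_top) (principal ({0<..} \<times> D)))"

end

theory Submission
  imports Defs "HOL-Real_Asymp.Real_Asymp"
begin

text \<open>Fix \<open>d\<close> and an accuracy \<open>\<epsilon>\<close>. The samples are taken on a fixed grid \<open>X\<close> of points with at
  most \<open>s + 1\<close> nonzero coordinates, all multiples of \<open>1/N\<close>. It is shown that two members
  \<open>g (a \<cdot> x)\<close> and \<open>h (b \<cdot> x)\<close> of the class with the same values on \<open>X\<close> differ by at most \<open>\<epsilon>\<close>; then any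
  member of the class that fits the data is a good reconstruction
  (\<open>err_le_if_determined_by_samples\<close>).

  Let \<open>v\<close> be the vector of the signs of the \<open>s\<close> or fewer large entries of \<open>a\<close>. Because \<open>\<parallel>a\<parallel>\<^sub>p \<le>
  1\<close> and \<open>p < 1\<close>, the value \<open>a \<cdot> v\<close> falls short of the maximum \<open>\<parallel>a\<parallel>\<^sub>1\<close> of \<open>a \<cdot> x\<close> over the cube
  by at most the order of \<open>s powr (1 - 1/p)\<close> (\<open>sparse_sign_vector\<close>), and the grid contains many
  points of the line through \<open>v\<close> together with their neighbours in all coordinate directions. If
  the profiles are flat along their lines, both functions are nearly constant. If one is steep
  somewhere, the neighbours reveal the gradients of both functions at this point, hence \<open>a\<close> and
  \<open>b\<close> are nearly proportional, and the values along the line transfer to all \<open>x\<close> with \<open>\<bar>a \<cdot> x\<bar> \<le>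
  a \<cdot> v\<close> (\<open>agreeing_ridge_functions_inner\<close>). The lower bound on \<open>\<parallel>a\<parallel>\<^sub>1\<close>, which is independent of
  \<open>d\<close>, makes the comparison of \<open>a\<close> and \<open>b\<close> stable.

  The values near the extreme ones of \<open>a \<cdot> x\<close> are not observed. There the difference of the two
  functions is extrapolated along rays (\<open>small_values_extrapolate\<close>): if a relative portion \<open>l\<close>
  of the range is unseen, smoothness of order \<open>r\<close> gives an error of order \<open>l powr r\<close>. So \<open>l\<close> may
  be as large as a multiple of \<open>\<epsilon> powr (1/r)\<close>, and \<open>s\<close> of order \<open>\<epsilon> powr (- p/(1-p)/r)\<close> suffices,
  while \<open>N\<close> is polynomial in \<open>1/\<epsilon>\<close>. The logarithm of the size of the grid is of order \<open>s * ln (d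
  * N)\<close>. With \<open>\<epsilon>\<close> and \<open>d\<close> expressed through \<open>z = 1/\<epsilon> + d\<close> this is \<open>o(z)\<close> because \<open>p/(1-p) < r\<close>.\<close>

section \<open>Linear forms on the cube\<close>

abbreviation ip :: "nat \<Rightarrow> (nat \<Rightarrow> real) \<Rightarrow> (nat \<Rightarrow> real) \<Rightarrow> real" where
  "ip d a x \<equiv> \<Sum>i<d. a i * x i"

lemma abs_ip_le:
  assumes "\<And>i. i < d \<Longrightarrow> \<bar>x i\<bar> \<le> 1"
  shows "\<bar>ip d a x\<bar> \<le> (\<Sum>i<d. \<bar>a i\<bar>)"
proof -
  have "\<bar>ip d a x\<bar> \<le> (\<Sum>i<d. \<bar>a i * x i\<bar>)" by (rule sum_abs)
  also have "\<dots> \<le> (\<Sum>i<d. \<bar>a i\<bar>)"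
    using assms by (intro sum_mono) (simp add: abs_mult mult_left_le)
  finally show ?thesis .
qed

lemma cube_coordinate_le: "x \<in> cube d \<Longrightarrow> i < d \<Longrightarrow> \<bar>x i\<bar> \<le> 1"
  by (force simp: cube_def PiE_iff abs_le_iff)

lemma ip_in_interval:
  assumes "(\<Sum>i<d. \<bar>a i\<bar>) \<le> 1" "\<And>i. i < d \<Longrightarrow> \<bar>x i\<bar> \<le> 1"
  shows "ip d a x \<in> {-1..1}"
  using abs_ip_le[of d x a] assms by (fastforce simp: abs_le_iff)

lemma ip_update: "i < d \<Longrightarrow> ip d a (x(i := x i + t)) = ip d a x + a i * t"
proof -
  assume i: "i < d"
  have "ip d a (x(i := x i + t)) = (\<Sum>j<d. a j * x j + (if j = i then a i * t else 0))"
    by (intro sum.cong) (auto simp: algebra_simps)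
  also have "\<dots> = ip d a x + a i * t" using i by (simp add: sum.distrib)
  finally show ?thesis .
qed

section \<open>Error bounds from nonadaptive sampling\<close>

text \<open>A fixed set of nodes suffices: after sampling on \<open>X\<close>, answer with any member of \<open>F\<close> that
  fits the data. The error is then controlled by how far two members of \<open>F\<close> with the same data
  can be apart, so that no reconstruction procedure has to be written down.\<close>

lemma err_le_if_determined_by_samples:
  assumes X: "finite X" "X \<subseteq> cube d" and F: "F \<subseteq> cont_funs d"
    and det: "\<And>f f' x. f \<in> F \<Longrightarrow> f' \<in> F \<Longrightarrow> \<forall>y\<in>X. f y = f' y \<Longrightarrow> x \<in> cube d \<Longrightarrow> \<bar>f x - f' x\<bar> \<le> \<epsilon>"
  shows "err (card X) d F \<le> ereal \<epsilon>"
proof -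
  obtain xs where xs: "set xs = X" "length xs = card X"
    using finite_distinct_list[OF X(1)] distinct_card by metis
  define \<psi> where "\<psi> = (\<lambda>ys :: real list. xs ! length ys)"
  define \<phi> where "\<phi> = (\<lambda>ys. if \<exists>f\<in>F. map f xs = ys then SOME f. f \<in> F \<and> map f xs = ys
    else restrict (\<lambda>_. 0) (cube d))"
  have obs: "observations \<psi> f n = map f (take n xs)" if "n \<le> card X" for f n
    using that
  proof (induction n)
    case (Suc n)
    then have "take (Suc n) xs = take n xs @ [xs ! n]"
      using xs(2) by (intro take_Suc_conv_app_nth) simp
    with Suc show ?case by (simp add: \<psi>_def xs(2))
  qed simp
  have obs_all: "observations \<psi> f (card X) = map f xs" for f
    using obs[of "card X" f] xs(2) by simp
  have \<phi>_cont: "\<phi> ys \<in> cont_funs d" for ys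
  proof (cases "\<exists>f\<in>F. map f xs = ys")
    case True
    then have "\<exists>f. f \<in> F \<and> map f xs = ys" by blast
    from someI_ex[OF this] True have "\<phi> ys \<in> F" by (simp add: \<phi>_def)
    with F show ?thesis by blast
  next
    case False
    have "continuous_on (cube d) (restrict (\<lambda>_. 0 :: real) (cube d))"
      by (subst continuous_on_cong[OF refl, where g = "\<lambda>_. 0"]) auto
    then show ?thesis unfolding \<phi>_def if_not_P[OF False] cont_funs_def by simp
  qed
  have close: "\<bar>f x - \<phi> (map f xs) x\<bar> \<le> \<epsilon>" if f: "f \<in> F" and x: "x \<in> cube d" for f x
  proof -
    have ex: "\<exists>f'. f' \<in> F \<and> map f' xs = map f xs" using f by blast
    then have "\<exists>f'\<in>F. map f' xs = map f xs" by blast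
    with someI_ex[OF ex] have *: "\<phi> (map f xs) \<in> F" "map (\<phi> (map f xs)) xs = map f xs"
      by (simp_all add: \<phi>_def)
    from *(2) xs(1) have "\<forall>y\<in>X. f y = \<phi> (map f xs) y" by (metis map_eq_conv)
    from det[OF f *(1) this x] show ?thesis .
  qed
  define A where "A = (\<lambda>f. \<phi> (map f xs))"
  have A: "A \<in> sampling_algorithms (card X) d F"
    unfolding sampling_algorithms_def
  proof (intro CollectI exI conjI allI ballI impI)
    show "\<psi> ys \<in> cube d" if "length ys < card X" for ys
      using that xs X(2) by (auto simp: \<psi>_def)
    show "\<phi> ys \<in> cont_funs d" for ys by (rule \<phi>_cont)
    show "A f = \<phi> (observations \<psi> f (card X))" for f by (simp add: A_def obs_all)
  qed
  have "(SUP f\<in>F. sup_norm_on (cube d) (\<lambda>x. f x - A f x)) \<le> ereal \<epsilon>"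
    unfolding sup_norm_on_def by (intro SUP_least) (simp add: A_def close)
  then show ?thesis unfolding err_def by (rule INF_lower2[OF A])
qed

lemma ridge_class_subset_cont_funs:
  assumes g: "\<And>g. g \<in> lip_ball r \<Longrightarrow> continuous_on {-1..1} g"
    and a: "\<And>a. lp_norm d p a \<le> 1 \<Longrightarrow> (\<Sum>i<d. \<bar>a i\<bar>) \<le> 1"
  shows "ridge_class r p S d \<subseteq> cont_funs d"
proof
  fix f assume "f \<in> ridge_class r p S d"
  then obtain g a where ga: "f = restrict (\<lambda>x. g (ip d a x)) (cube d)"
    "g \<in> lip_ball r" "lp_norm d p a \<le> 1"
    unfolding ridge_class_def by blast
  have "ip d a x \<in> {-1..1}" if "x \<in> cube d" for x
    using ip_in_interval[OF a[OF ga(3)] cube_coordinate_le[OF that]] .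
  then have "continuous_on (cube d) (\<lambda>x. g (ip d a x))"
    by (intro continuous_on_compose2[OF g[OF ga(2)]] continuous_intros
        continuous_on_subset[OF continuous_on_product_coordinates]) auto
  then have "continuous_on (cube d) f"
    unfolding ga(1) by (subst continuous_on_cong[OF refl, where g = "\<lambda>x. g (ip d a x)"]) auto
  then show "f \<in> cont_funs d" by (simp add: cont_funs_def ga(1))
qed

section \<open>Sparse grids\<close>

text \<open>The points of the cube with at most \<open>k\<close> nonzero coordinates, all in \<open>\<int>/N\<close>. Building them
  by \<open>k\<close> single-coordinate updates gives at once the cardinality bound and the closure under
  changing one further coordinate, which is how partial derivatives are observed.\<close>

primrec sparse_grid :: "nat \<Rightarrow> nat \<Rightarrow> nat \<Rightarrow> (nat \<Rightarrow> real) set" where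
  "sparse_grid d N 0 = {\<lambda>i\<in>{..<d}. 0}"
| "sparse_grid d N (Suc k) = (\<lambda>(x, i, j). x(i := real_of_int j / real N)) `
     (sparse_grid d N k \<times> {..<d} \<times> {- int N..int N})"

lemma finite_sparse_grid: "finite (sparse_grid d N k)"
  by (induction k) auto

lemma card_sparse_grid_le: "card (sparse_grid d N k) \<le> (d * (2 * N + 1)) ^ k"
proof (induction k)
  case (Suc k)
  have "card (sparse_grid d N (Suc k)) \<le> card (sparse_grid d N k \<times> {..<d} \<times> {- int N..int N})"
    unfolding sparse_grid.simps by (intro card_image_le) (auto simp: finite_sparse_grid)
  also have "\<dots> = card (sparse_grid d N k) * (d * (2 * N + 1))"
  proof -
    have "nat (2 * int N + 1) = 2 * N + 1" by linarith
    then show ?thesis by (simp add: card_cartesian_product algebra_simps)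
  qed
  also have "\<dots> \<le> (d * (2 * N + 1)) ^ Suc k" using Suc by (simp add: mult.commute)
  finally show ?case .
qed simp

lemma sparse_grid_coordinate:
  "x \<in> sparse_grid d N k \<Longrightarrow> i < d \<Longrightarrow> \<exists>j\<in>{- int N..int N}. x i = real_of_int j / real N"
proof (induction k arbitrary: x)
  case 0 then show ?case by (auto intro!: bexI[of _ 0])
next
  case (Suc k) then show ?case by (fastforce simp: fun_upd_apply)
qed

lemma sparse_grid_subset_cube: "sparse_grid d N k \<subseteq> cube d"
proof (induction k)
  case 0 then show ?case by (auto simp: cube_def)
next
  case (Suc k)
  have "\<bar>real_of_int j / real N\<bar> \<le> 1" if "j \<in> {- int N..int N}" for j
    using that by (auto simp: divide_le_eq_1)
  then have "real_of_int j / real N \<in> {-1..1}" if "j \<in> {- int N..int N}" for j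
    using that by (metis abs_le_iff atLeastAtMost_iff minus_le_iff)
  then have "x(i := real_of_int j / real N) \<in> cube d"
    if "x \<in> cube d" "i < d" "j \<in> {- int N..int N}" for x i j
    using that unfolding cube_def PiE_iff extensional_def by auto
  with Suc show ?case by auto
qed

lemma sparse_grid_SucI:
  assumes "x \<in> sparse_grid d N k" "i < d" "j \<in> {- int N..int N}"
  shows "x(i := real_of_int j / real N) \<in> sparse_grid d N (Suc k)"
  using assms by (auto intro!: image_eqI[where x = "(x, i, j)"])

lemma sparse_grid_mono:
  assumes "0 < d" "k \<le> l" shows "sparse_grid d N k \<subseteq> sparse_grid d N l"
  using assms(2)
proof (induction rule: dec_induct)
  case (step l)
  have "x \<in> sparse_grid d N (Suc l)" if x: "x \<in> sparse_grid d N l" for x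
  proof -
    obtain j where j: "j \<in> {- int N..int N}" "x 0 = real_of_int j / real N"
      using sparse_grid_coordinate[OF x assms(1)] by blast
    have "x = x(0 := real_of_int j / real N)" using j(2) by (metis fun_upd_triv)
    with sparse_grid_SucI[OF x assms(1) j(1)] show ?thesis by simp
  qed
  with step show ?case by blast
qed simp

lemma sparse_grid_neighbour:
  assumes x: "x \<in> sparse_grid d N k" and i: "i < d" and N: "0 < N"
  shows "\<exists>\<sigma>\<in>{-1, 1}. x(i := x i + \<sigma> / real N) \<in> sparse_grid d N (Suc k)"
proof -
  obtain j where j: "j \<in> {- int N..int N}" "x i = real_of_int j / real N"
    using sparse_grid_coordinate[OF x i] by blast
  have eq: "real_of_int (j + \<tau>) / real N = x i + real_of_int \<tau> / real N" for \<tau>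
    by (simp add: j(2) add_divide_distrib)
  show ?thesis
  proof (cases "j = int N")
    case True
    then have "j + (-1) \<in> {- int N..int N}" using N by auto
    from sparse_grid_SucI[OF x i this] show ?thesis unfolding eq by (intro bexI[of _ "-1"]) auto
  next
    case False
    then have "j + 1 \<in> {- int N..int N}" using j(1) by auto
    from sparse_grid_SucI[OF x i this] show ?thesis unfolding eq by (intro bexI[of _ 1]) auto
  qed
qed

declare sparse_grid.simps(2) [simp del]

lemma scaled_sign_vector_in_sparse_grid:
  assumes U: "finite U" "U \<subseteq> {..<d}" and \<sigma>: "\<And>i. i \<in> U \<Longrightarrow> \<sigma> i \<in> {-1, 1 :: int}"
    and j: "j \<in> {- int N..int N}"
  shows "(\<lambda>i\<in>{..<d}. if i \<in> U then real_of_int (\<sigma> i * j) / real N else 0) \<in> sparse_grid d N (card U)"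
  using U \<sigma>
proof (induction U rule: finite_induct)
  case (insert i U)
  let ?x = "\<lambda>U. \<lambda>i\<in>{..<d}. if i \<in> U then real_of_int (\<sigma> i * j) / real N else 0"
  have j: "\<sigma> i * j \<in> {- int N..int N}" using insert.prems(2)[of i] j by auto
  have x: "?x U \<in> sparse_grid d N (card U)"
    by (rule insert.IH) (use insert.prems in blast)+
  have i: "i < d" using insert.prems(1) by auto
  have "?x (insert i U) = (?x U)(i := real_of_int (\<sigma> i * j) / real N)"
    using i by (auto simp: fun_eq_iff)
  with sparse_grid_SucI[OF x i j] show ?case by (simp only: card_insert_disjoint[OF insert.hyps])
qed (simp add: restrict_def)

section \<open>Extrapolation of small values of smooth functions\<close>

text \<open>A quantitative form of Rolle's theorem. If \<open>w\<^sup>(\<^sup>k\<^sup>)\<close> is small at a point of the first and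
  at a point of the last third of an interval, then the mean value theorem between them makes
  the next derivative small at a point in between; hence the lengths \<open>\<rho> * 3 ^ k\<close>.\<close>

lemma derivative_small_somewhere:
  fixes w :: "nat \<Rightarrow> real \<Rightarrow> real"
  assumes der: "\<And>k u. k < m \<Longrightarrow> u \<in> I \<Longrightarrow> (w k has_real_derivative w (Suc k) u) (at u within I)"
    and \<rho>: "0 < \<rho>" and small: "\<And>u. u \<in> J \<Longrightarrow> \<bar>w 0 u\<bar> \<le> \<kappa>" and J: "J \<subseteq> I" and k: "k \<le> m"
    and sub: "{c..c + \<rho> * 3 ^ k} \<subseteq> J"
  shows "\<exists>\<xi>\<in>{c..c + \<rho> * 3 ^ k}. \<bar>w k \<xi>\<bar> \<le> \<kappa> * (2 / \<rho>) ^ k"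
  using k sub
proof (induction k arbitrary: c)
  case 0
  then have "c \<in> J" using \<rho> by auto
  with small[OF this] \<rho> show ?case by (intro bexI[of _ c]) auto
next
  case (Suc k)
  define L where "L = \<rho> * 3 ^ k"
  have "1 \<le> (3 :: real) ^ k" by simp
  then have L: "\<rho> \<le> L" using \<rho> unfolding L_def by simp
  have sub: "{c..c + 3 * L} \<subseteq> J" using Suc.prems(2) by (simp add: L_def mult_ac)
  obtain \<xi> where \<xi>: "\<xi> \<in> {c..c + L}" "\<bar>w k \<xi>\<bar> \<le> \<kappa> * (2 / \<rho>) ^ k"
    using Suc.IH[of c] Suc.prems(1) sub L \<rho> unfolding L_def[symmetric] by force
  obtain \<zeta> where \<zeta>: "\<zeta> \<in> {c + 2 * L..c + 2 * L + L}" "\<bar>w k \<zeta>\<bar> \<le> \<kappa> * (2 / \<rho>) ^ k"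
    using Suc.IH[of "c + 2 * L"] Suc.prems(1) sub L \<rho> unfolding L_def[symmetric] by force
  have less: "\<xi> < \<zeta>" "\<rho> \<le> \<zeta> - \<xi>" using \<xi>(1) \<zeta>(1) L \<rho> by auto
  have inner: "{\<xi>..\<zeta>} \<subseteq> {c..c + 3 * L}" using \<xi>(1) \<zeta>(1) by auto
  have "(w k has_derivative (\<lambda>h. w (Suc k) u * h)) (at u within {\<xi>..\<zeta>})" if "u \<in> {\<xi>..\<zeta>}" for u
  proof -
    have "u \<in> I" "{\<xi>..\<zeta>} \<subseteq> I" using that inner sub J by blast+
    then show ?thesis
      using der[of k u] Suc.prems(1) by (auto simp: has_field_derivative_def intro: has_derivative_subset)
  qed
  then obtain u where u: "u \<in> {\<xi><..<\<zeta>}" "w k \<zeta> - w k \<xi> = w (Suc k) u * (\<zeta> - \<xi>)"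
    using mvt_simple[OF less(1), of "w k" "\<lambda>u h. w (Suc k) u * h"] by auto
  have "\<rho> * \<bar>w (Suc k) u\<bar> \<le> \<bar>w (Suc k) u * (\<zeta> - \<xi>)\<bar>"
    using less \<rho> by (simp add: abs_mult mult_mono mult.commute)
  also have "\<dots> \<le> 2 * (\<kappa> * (2 / \<rho>) ^ k)" using \<xi>(2) \<zeta>(2) unfolding u(2)[symmetric] by linarith
  finally have "\<bar>w (Suc k) u\<bar> \<le> \<kappa> * (2 / \<rho>) ^ Suc k" using \<rho> by (simp add: field_simps)
  moreover have "u \<in> {c..c + \<rho> * 3 ^ Suc k}"
    using u(1) inner by (auto simp: L_def mult_ac subset_iff)
  ultimately show ?case by blast
qed

text \<open>Smallness on \<open>[c, c + l]\<close>, amplified by a factor that is polynomial in \<open>1/l\<close>, persists on the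
  interval of twice the length up to the Taylor-type error \<open>M * (2 * l) powr (\<beta> + m)\<close>. Each derivative is small at some point by the
  previous lemma; the Hoelder condition spreads the smallness of the top derivative over the
  interval, and integrating downwards gains a factor \<open>2 * l\<close> per order.\<close>

lemma small_values_extrapolate:
  fixes w :: "nat \<Rightarrow> real \<Rightarrow> real"
  assumes der: "\<And>k u. k < m \<Longrightarrow> u \<in> I \<Longrightarrow> (w k has_real_derivative w (Suc k) u) (at u within I)"
    and holder: "\<And>u v. u \<in> I \<Longrightarrow> v \<in> I \<Longrightarrow> \<bar>w m u - w m v\<bar> \<le> M * \<bar>u - v\<bar> powr \<beta>"
    and I: "{c..c + 2 * l} \<subseteq> I" and l: "0 < l" "2 * l \<le> 1" and \<beta>: "0 \<le> \<beta>" and M: "0 \<le> M"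
    and small: "\<And>u. u \<in> {c..c + l} \<Longrightarrow> \<bar>w 0 u\<bar> \<le> \<kappa>"
    and u: "u \<in> {c..c + 2 * l}"
  shows "\<bar>w 0 u\<bar> \<le> real (Suc m) * (\<kappa> * (2 * 3 ^ m / l) ^ m) + M * (2 * l) powr (\<beta> + real m)"
proof -
  define E where "E = \<kappa> * (2 * 3 ^ m / l) ^ m"
  have \<kappa>: "0 \<le> \<kappa>" using small[of c] l(1) by auto
  have "1 \<le> (3 :: real) ^ m" by simp
  then have "l \<le> 2 * 3 ^ m" using l by linarith
  then have base: "1 \<le> 2 * 3 ^ m / l" using l by (simp add: le_divide_eq)
  have E: "0 \<le> E" using \<kappa> l by (simp add: E_def)
  have ex: "\<exists>\<xi>\<in>{c..c + 2 * l}. \<bar>w k \<xi>\<bar> \<le> E" if k: "k \<le> m" for k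
  proof -
    have "l / 3 ^ m * 3 ^ k \<le> l / 3 ^ m * 3 ^ m"
      using k l by (intro mult_left_mono power_increasing) auto
    then have le: "l / 3 ^ m * 3 ^ k \<le> l" by simp
    have "\<exists>\<xi>\<in>{c..c + l / 3 ^ m * 3 ^ k}. \<bar>w k \<xi>\<bar> \<le> \<kappa> * (2 / (l / 3 ^ m)) ^ k"
    proof (rule derivative_small_somewhere[where m = m and I = I and J = "{c..c + l}"])
      show "{c..c + l} \<subseteq> I" using I l(1) by (auto simp: subset_iff)
    qed (use der small l k le in auto)
    then obtain \<xi> where \<xi>: "\<xi> \<in> {c..c + l / 3 ^ m * 3 ^ k}" "\<bar>w k \<xi>\<bar> \<le> \<kappa> * (2 / (l / 3 ^ m)) ^ k" ..
    have "\<kappa> * (2 * 3 ^ m / l) ^ k \<le> E"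
      unfolding E_def using base k \<kappa> by (intro mult_left_mono power_increasing) auto
    with \<xi> le l(1) show ?thesis by (intro bexI[of _ \<xi>]) auto
  qed
  have bound: "\<bar>w (m - i) u\<bar> \<le> real (Suc i) * E + M * (2 * l) powr (\<beta> + real i)"
    if "i \<le> m" "u \<in> {c..c + 2 * l}" for i u
    using that
  proof (induction i arbitrary: u)
    case 0
    obtain \<xi> where \<xi>: "\<xi> \<in> {c..c + 2 * l}" "\<bar>w m \<xi>\<bar> \<le> E" using ex[of m] by auto
    have "\<bar>w m u - w m \<xi>\<bar> \<le> M * \<bar>u - \<xi>\<bar> powr \<beta>" using 0 \<xi>(1) I by (intro holder) auto
    also have "\<dots> \<le> M * (2 * l) powr \<beta>"
      using 0 \<xi>(1) M \<beta> by (intro mult_left_mono powr_mono2) auto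
    finally show ?case using \<xi>(2) by simp
  next
    case (Suc i)
    define B where "B = real (Suc i) * E + M * (2 * l) powr (\<beta> + real i)"
    define k where "k = m - Suc i"
    have k: "k < m" "Suc k = m - i" using Suc.prems(1) by (auto simp: k_def)
    obtain \<xi> where \<xi>: "\<xi> \<in> {c..c + 2 * l}" "\<bar>w k \<xi>\<bar> \<le> E" using ex[of k] k by auto
    have "norm (w k u - w k \<xi>) \<le> B * norm (u - \<xi>)"
    proof (rule field_differentiable_bound[where S = "{c..c + 2 * l}"])
      show "(w k has_real_derivative w (Suc k) v) (at v within {c..c + 2 * l})"
        if "v \<in> {c..c + 2 * l}" for v
        using that I k(1) by (intro DERIV_subset[OF der I]) auto
      show "norm (w (Suc k) v) \<le> B" if "v \<in> {c..c + 2 * l}" for v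
        using Suc.IH[of v] Suc.prems(1) that by (simp add: k B_def)
    qed (use \<xi>(1) Suc.prems(2) in auto)
    also have "\<dots> \<le> B * (2 * l)"
      using \<xi>(1) Suc.prems(2) E M by (intro mult_left_mono) (auto simp: B_def)
    also have "\<dots> = real (Suc i) * E * (2 * l) + M * ((2 * l) powr (\<beta> + real i) * (2 * l) powr 1)"
      using l by (simp add: B_def algebra_simps)
    also have "(2 * l) powr (\<beta> + real i) * (2 * l) powr 1 = (2 * l) powr (\<beta> + real (Suc i))"
      by (simp only: powr_add[symmetric] add.assoc of_nat_Suc add.commute[of 1])
    also have "real (Suc i) * E * (2 * l) \<le> real (Suc i) * E"
      using l E by (intro mult_left_le) auto
    finally have "\<bar>w k u\<bar> \<le> E + (real (Suc i) * E + M * (2 * l) powr (\<beta> + real (Suc i)))"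
      using \<xi>(2) unfolding real_norm_def by linarith
    then show ?case by (simp add: k_def algebra_simps)
  qed
  show ?thesis using bound[of m u] u by (simp add: E_def)
qed

section \<open>Profiles in the Lipschitz ball\<close>

lemma lip_ball_derivatives:
  assumes g: "g \<in> lip_ball r"
  defines "m \<equiv> smooth_order r" and "G \<equiv> \<lambda>k. nth_deriv k g"
  shows "\<And>k u. k < m \<Longrightarrow> u \<in> {-1..1} \<Longrightarrow> (G k has_real_derivative G (Suc k) u) (at u within {-1..1})"
    and "\<And>k u. k \<le> m \<Longrightarrow> u \<in> {-1..1} \<Longrightarrow> \<bar>G k u\<bar> \<le> 1"
    and "\<And>u v. u \<in> {-1..1} \<Longrightarrow> v \<in> {-1..1} \<Longrightarrow>
      0 \<le> r - real m \<Longrightarrow> \<bar>G m u - G m v\<bar> \<le> 2 * \<bar>u - v\<bar> powr (r - real m)"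
proof -
  have tcd: "times_cont_diff m g" and sup: "\<And>k. k \<le> m \<Longrightarrow> sup_norm_on {-1..1} (G k) \<le> 1"
    and hol: "holder_seminorm (r - real m) (G m) \<le> 1"
    using g by (auto simp: lip_ball_def m_def G_def)
  show "(G k has_real_derivative G (Suc k) u) (at u within {-1..1})" if "k < m" "u \<in> {-1..1}" for k u
  proof -
    have "G k differentiable (at u within {-1..1})"
      using tcd that by (auto simp: times_cont_diff_def differentiable_on_def G_def)
    then have "(G k has_vector_derivative vector_derivative (G k) (at u within {-1..1})) (at u within {-1..1})"
      using vector_derivative_works by blast
    then show ?thesis
      by (simp add: has_real_derivative_iff_has_vector_derivative G_def nth_deriv_def)
  qed
  show "\<bar>G k u\<bar> \<le> 1" if "k \<le> m" "u \<in> {-1..1}" for k u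
  proof -
    have "ereal \<bar>G k u\<bar> \<le> sup_norm_on {-1..1} (G k)"
      unfolding sup_norm_on_def by (rule SUP_upper[OF that(2)])
    also note sup[OF that(1)]
    finally show ?thesis by (simp add: one_ereal_def)
  qed
  show "\<bar>G m u - G m v\<bar> \<le> 2 * \<bar>u - v\<bar> powr (r - real m)"
    if uv: "u \<in> {-1..1}" "v \<in> {-1..1}" and \<beta>: "0 \<le> r - real m" for u v
  proof (cases "u = v")
    case False
    let ?M = "min 1 \<bar>u - v\<bar> powr (r - real m)"
    have "ereal (\<bar>G m u - G m v\<bar> / (2 * ?M)) \<le> holder_seminorm (r - real m) (G m)"
      unfolding holder_seminorm_def
      by (rule SUP_upper2[where i = "(u, v)"]) (use uv False in auto)
    also note hol
    finally have "\<bar>G m u - G m v\<bar> / (2 * ?M) \<le> 1" by (simp add: one_ereal_def)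
    moreover have "0 < ?M" using False by simp
    ultimately have "\<bar>G m u - G m v\<bar> \<le> 2 * ?M" by (simp add: divide_le_eq)
    also have "?M \<le> \<bar>u - v\<bar> powr (r - real m)" using \<beta> by (intro powr_mono2) auto
    finally show ?thesis by simp
  qed simp
qed

lemma smooth_order_bounds:
  assumes "1 < r"
  shows "1 \<le> smooth_order r" "real (smooth_order r) < r" "r \<le> real (smooth_order r) + 1"
  using assms unfolding smooth_order_def by linarith+

text \<open>The smoothness of a profile that enters the comparison of gradients. The higher
  derivatives matter only for the extrapolation.\<close>

definition holder_gradient :: "real \<Rightarrow> (real \<Rightarrow> real) \<Rightarrow> (real \<Rightarrow> real) \<Rightarrow> bool" where
  "holder_gradient \<gamma> g g' \<longleftrightarrow>
     (\<forall>u\<in>{-1..1}. (g has_real_derivative g' u) (at u within {-1..1}) \<and> \<bar>g' u\<bar> \<le> 1) \<and>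
     (\<forall>u\<in>{-1..1}. \<forall>v\<in>{-1..1}. \<bar>g' u - g' v\<bar> \<le> 2 * \<bar>u - v\<bar> powr \<gamma>)"

lemma holder_gradient_lipschitz:
  assumes "holder_gradient \<gamma> g g'" "u \<in> {-1..1}" "v \<in> {-1..1}"
  shows "\<bar>g u - g v\<bar> \<le> \<bar>u - v\<bar>"
proof -
  have "norm (g u - g v) \<le> 1 * norm (u - v)"
    using assms by (intro field_differentiable_bound[where S = "{-1..1}" and f' = g'])
      (auto simp: holder_gradient_def)
  then show ?thesis by simp
qed

text \<open>For \<open>r > 2\<close> the bound on the second derivative gives exponent \<open>1\<close>; otherwise the
  derivative itself is the top one, with Hoelder exponent \<open>r - 1\<close>.\<close>

lemma lip_ball_holder_gradient:
  assumes g: "g \<in> lip_ball r" and r: "1 < r"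
  shows "holder_gradient (min 1 (r - 1)) g (nth_deriv 1 g)"
proof -
  define m where "m = smooth_order r"
  note m = smooth_order_bounds[OF r, folded m_def]
  note D = lip_ball_derivatives[OF g, folded m_def]
  have der: "(g has_real_derivative nth_deriv 1 g u) (at u within {-1..1})" if "u \<in> {-1..1}" for u
    using D(1)[of 0 u] m(1) that by (simp add: nth_deriv_def)
  have "\<bar>nth_deriv 1 g u - nth_deriv 1 g v\<bar> \<le> 2 * \<bar>u - v\<bar> powr min 1 (r - 1)"
    if uv: "u \<in> {-1..1}" "v \<in> {-1..1}" for u v
  proof (cases "m = 1")
    case True
    then have "min 1 (r - 1) = r - real m" using m by auto
    then show ?thesis using D(3)[OF uv] True m by simp
  next
    case False
    then have m2: "2 \<le> m" using m by auto
    have "norm (nth_deriv 1 g u - nth_deriv 1 g v) \<le> 1 * norm (u - v)"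
    proof (rule field_differentiable_bound[where S = "{-1..1}" and f' = "nth_deriv (Suc 1) g"])
      show "(nth_deriv 1 g has_real_derivative nth_deriv (Suc 1) g x) (at x within {-1..1})"
        if "x \<in> {-1..1}" for x using D(1)[of 1 x] that m2 by simp
      show "norm (nth_deriv (Suc 1) g x) \<le> 1" if "x \<in> {-1..1}" for x
        using D(2)[of "Suc 1" x] that m2 by simp
    qed (use uv in auto)
    moreover have "min 1 (r - 1) = 1" using m2 m(2) by auto
    moreover have "\<bar>u - v\<bar> powr 1 = \<bar>u - v\<bar>" by simp
    ultimately show ?thesis by (simp only: real_norm_def)
  qed
  then show ?thesis
    using der D(2)[of 1] m(1) by (simp add: holder_gradient_def)
qed

section \<open>Ridge functions that agree on a sparse grid\<close>

lemma holder_gradient_first_order: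
  assumes g: "holder_gradient \<gamma> g g'" and uv: "u \<in> {-1..1}" "v \<in> {-1..1}" and \<gamma>: "0 \<le> \<gamma>"
    and \<delta>: "\<bar>v - u\<bar> \<le> \<delta>"
  shows "\<bar>g v - g u - g' u * (v - u)\<bar> \<le> 2 * \<delta> powr \<gamma> * \<bar>v - u\<bar>"
proof -
  let ?S = "closed_segment u v"
  have S: "?S \<subseteq> {-1..1}" using uv by (intro closed_segment_subset) auto
  have "norm ((g v - g' u * v) - (g u - g' u * u)) \<le> 2 * \<delta> powr \<gamma> * norm (v - u)"
  proof (rule field_differentiable_bound[where S = ?S and f' = "\<lambda>w. g' w - g' u * 1"])
    show "((\<lambda>w. g w - g' u * w) has_real_derivative g' w - g' u * 1) (at w within ?S)"
      if "w \<in> ?S" for w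
    proof -
      have "(g has_real_derivative g' w) (at w within ?S)"
        using g that S by (intro DERIV_subset[OF _ S]) (auto simp: holder_gradient_def subset_iff)
      then show ?thesis by (intro derivative_intros DERIV_cmult) auto
    qed
    show "norm (g' w - g' u * 1) \<le> 2 * \<delta> powr \<gamma>" if w: "w \<in> ?S" for w
    proof -
      have "\<bar>w - u\<bar> \<le> \<delta>" using w \<delta> by (auto simp: closed_segment_eq_real_ivl split: if_splits)
      then have "2 * \<bar>w - u\<bar> powr \<gamma> \<le> 2 * \<delta> powr \<gamma>" using \<gamma> by (simp add: powr_mono2)
      moreover have "\<bar>g' w - g' u\<bar> \<le> 2 * \<bar>w - u\<bar> powr \<gamma>"
        using g w S uv unfolding holder_gradient_def by blast
      ultimately show ?thesis by simp
    qed
  qed auto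
  then show ?thesis by (simp add: algebra_simps)
qed

text \<open>Moving from a grid point to a neighbour in direction \<open>i\<close> observes the \<open>i\<close>-th partial
  derivative up to an error proportional to the \<open>i\<close>-th weights. Summed over \<open>i\<close>, the errors
  involve only the \<open>\<ell>\<^sub>1\<close>-norms, so that the resolution \<open>N\<close> need not grow with the dimension.\<close>

lemma agreeing_ridge_gradients:
  assumes g: "holder_gradient \<gamma> g g'" and h: "holder_gradient \<gamma> h h'" and \<gamma>: "0 \<le> \<gamma>" and N: "0 < N"
    and a: "(\<Sum>i<d. \<bar>a i\<bar>) \<le> 1" and b: "(\<Sum>i<d. \<bar>b i\<bar>) \<le> 1"
    and agree: "\<And>x. x \<in> sparse_grid d N (Suc s) \<Longrightarrow> g (ip d a x) = h (ip d b x)"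
    and x: "x \<in> sparse_grid d N s" and d: "0 < d"
  shows "(\<Sum>i<d. \<bar>g' (ip d a x) * a i - h' (ip d b x) * b i\<bar>) \<le> 4 * (1 / real N) powr \<gamma>"
proof -
  define D where "D = (1 / real N) powr \<gamma>"
  have agree_x: "g (ip d a x) = h (ip d b x)"
    using agree x sparse_grid_mono[OF d, of s "Suc s" N] by auto
  have component: "\<bar>g' (ip d a x) * a i - h' (ip d b x) * b i\<bar> \<le> 2 * D * (\<bar>a i\<bar> + \<bar>b i\<bar>)"
    if i: "i < d" for i
  proof -
    obtain \<sigma> :: real where \<sigma>: "\<sigma> \<in> {-1, 1}" "x(i := x i + \<sigma> / real N) \<in> sparse_grid d N (Suc s)"
      using sparse_grid_neighbour[OF x i N] by blast
    let ?y = "x(i := x i + \<sigma> / real N)"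
    have cube: "x \<in> cube d" "?y \<in> cube d" using x \<sigma>(2) sparse_grid_subset_cube by blast+
    have expand: "\<bar>f (ip d c ?y) - f (ip d c x) - f' (ip d c x) * (c i * (\<sigma> / real N))\<bar>
        \<le> 2 * D * (\<bar>c i\<bar> / real N)"
      if f: "holder_gradient \<gamma> f f'" and c: "(\<Sum>i<d. \<bar>c i\<bar>) \<le> 1" for f f' c
    proof -
      have diff: "ip d c ?y - ip d c x = c i * (\<sigma> / real N)" by (simp only: ip_update[OF i])
      have abs: "\<bar>c i * (\<sigma> / real N)\<bar> = \<bar>c i\<bar> / real N" using \<sigma>(1) by (auto simp: abs_mult)
      have "\<bar>c i\<bar> \<le> (\<Sum>i<d. \<bar>c i\<bar>)" using i by (intro member_le_sum) auto
      with c have "\<bar>c i\<bar> / real N \<le> 1 / real N" by (intro divide_right_mono) auto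
      then show ?thesis
        using holder_gradient_first_order[OF f, of "ip d c x" "ip d c ?y" "1 / real N"]
          ip_in_interval[OF c cube_coordinate_le[OF cube(1)]]
          ip_in_interval[OF c cube_coordinate_le[OF cube(2)]] \<gamma>
        unfolding diff abs D_def by simp
    qed
    have "\<bar>(g' (ip d a x) * a i - h' (ip d b x) * b i) * (\<sigma> / real N)\<bar>
        \<le> 2 * D * (\<bar>a i\<bar> / real N) + 2 * D * (\<bar>b i\<bar> / real N)"
      using expand[OF g a] expand[OF h b] agree_x agree[OF \<sigma>(2)] by (simp add: algebra_simps)
    moreover have "\<bar>(g' (ip d a x) * a i - h' (ip d b x) * b i) * (\<sigma> / real N)\<bar>
        = \<bar>g' (ip d a x) * a i - h' (ip d b x) * b i\<bar> / real N"
      using \<sigma>(1) by (auto simp: abs_mult)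
    ultimately show ?thesis using N by (simp add: field_simps)
  qed
  have "(\<Sum>i<d. \<bar>g' (ip d a x) * a i - h' (ip d b x) * b i\<bar>) \<le> (\<Sum>i<d. 2 * D * (\<bar>a i\<bar> + \<bar>b i\<bar>))"
    using component by (intro sum_mono) auto
  also have "\<dots> = 2 * D * ((\<Sum>i<d. \<bar>a i\<bar>) + (\<Sum>i<d. \<bar>b i\<bar>))"
    by (simp add: sum_distrib_left[symmetric] sum.distrib)
  also have "\<dots> \<le> 2 * D * 2" using a b by (intro mult_left_mono) (auto simp: D_def)
  finally show ?thesis by (simp add: D_def)
qed

lemma nearest_grid_fraction:
  assumes N: "0 < N" and t: "\<bar>t\<bar> \<le> (1 :: real)"
  shows "\<exists>j\<in>{- int N..int N}. \<bar>t - real_of_int j / real N\<bar> \<le> 1 / real N"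
proof -
  have "\<bar>t * real N\<bar> \<le> real N" using t by (simp add: abs_mult mult_left_le_one_le)
  then have "\<lfloor>t * real N\<rfloor> \<in> {- int N..int N}" by (auto simp: le_floor_iff floor_le_iff)
  moreover have "\<bar>t - real_of_int \<lfloor>t * real N\<rfloor> / real N\<bar> \<le> 1 / real N"
  proof -
    have "t - real_of_int \<lfloor>t * real N\<rfloor> / real N = (t * real N - real_of_int \<lfloor>t * real N\<rfloor>) / real N"
      using N by (simp add: field_simps)
    moreover have "\<bar>t * real N - real_of_int \<lfloor>t * real N\<rfloor>\<bar> \<le> 1" by linarith
    ultimately show ?thesis by (simp add: divide_right_mono)
  qed
  ultimately show ?thesis by blast
qed

lemma nearest_grid_multiple:
  assumes N: "0 < N" and T: "0 < T" "T \<le> 1" and y: "\<bar>y\<bar> \<le> (T :: real)"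
  shows "\<exists>j\<in>{- int N..int N}. \<bar>y - real_of_int j / real N * T\<bar> \<le> 1 / real N"
proof -
  have "\<bar>y / T\<bar> \<le> 1" using T y by simp
  from nearest_grid_fraction[OF N this] obtain j where
    j: "j \<in> {- int N..int N}" "\<bar>y / T - real_of_int j / real N\<bar> \<le> 1 / real N" by blast
  have "y - real_of_int j / real N * T = (y / T - real_of_int j / real N) * T"
    using T by (simp add: field_simps)
  then have "\<bar>y - real_of_int j / real N * T\<bar> = \<bar>y / T - real_of_int j / real N\<bar> * T"
    using T by (simp add: abs_mult)
  also have "\<dots> \<le> 1 / real N * 1" using j(2) T by (intro mult_mono) auto
  finally show ?thesis using j(1) by auto
qed

text \<open>The Hoelder condition carries the bound on the derivative from the grid points over to all
  of \<open>[-T, T]\<close>, where the mean value theorem applies.\<close>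

lemma flat_profile:
  assumes g: "holder_gradient \<gamma> g g'" and \<gamma>: "0 \<le> \<gamma>" and N: "0 < N" and T: "0 < T" "T \<le> 1"
    and flat: "\<And>j. j \<in> {- int N..int N} \<Longrightarrow> \<bar>g' (real_of_int j / real N * T)\<bar> \<le> A"
    and y: "\<bar>y\<bar> \<le> T"
  shows "\<bar>g y - g 0\<bar> \<le> A + 2 * (1 / real N) powr \<gamma>"
proof -
  define B where "B = A + 2 * (1 / real N) powr \<gamma>"
  have "0 \<le> A" using flat[of 0] by auto
  then have B: "0 \<le> B" by (simp add: B_def)
  have "norm (g y - g 0) \<le> B * norm (y - 0)"
  proof (rule field_differentiable_bound[where S = "{-T..T}" and f' = g'])
    show "(g has_real_derivative g' u) (at u within {-T..T})" if "u \<in> {-T..T}" for u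
    proof (rule DERIV_subset[where s = "{-1..1}"])
      show "(g has_real_derivative g' u) (at u within {-1..1})"
        using g that T unfolding holder_gradient_def by auto
    qed (use T in auto)
    show "norm (g' u) \<le> B" if u: "u \<in> {-T..T}" for u
    proof -
      have "\<bar>u\<bar> \<le> T" using u by (simp add: abs_le_iff minus_le_iff)
      from nearest_grid_multiple[OF N T this] obtain j where
        j: "j \<in> {- int N..int N}" "\<bar>u - real_of_int j / real N * T\<bar> \<le> 1 / real N" by blast
      have "\<bar>real_of_int j / real N\<bar> \<le> 1" using j(1) N by (auto simp: divide_le_eq_1)
      then have "\<bar>real_of_int j / real N\<bar> * \<bar>T\<bar> \<le> 1" using T by (intro mult_le_one) auto
      then have "\<bar>real_of_int j / real N * T\<bar> \<le> 1" by (simp only: abs_mult)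
      then have "real_of_int j / real N * T \<in> {-1..1}" unfolding atLeastAtMost_iff by linarith
      moreover have "u \<in> {-1..1}" using u T by auto
      ultimately have "\<bar>g' u - g' (real_of_int j / real N * T)\<bar>
          \<le> 2 * \<bar>u - real_of_int j / real N * T\<bar> powr \<gamma>"
        using g unfolding holder_gradient_def by blast
      also have "\<dots> \<le> 2 * (1 / real N) powr \<gamma>" using j(2) \<gamma> by (simp add: powr_mono2)
      finally show ?thesis using flat[OF j(1)] by (simp add: B_def)
    qed
  qed (use y T in \<open>auto simp: abs_le_iff\<close>)
  also have "\<dots> \<le> B" using y T B by (simp add: mult_left_le)
  finally show ?thesis by (simp add: B_def)
qed

text \<open>If \<open>g'\<close> is not small at one grid point of the line through \<open>v\<close>, the gradients at this
  point show that \<open>a\<close> and \<open>b\<close> are nearly proportional. Every \<open>x\<close> with \<open>\<bar>a \<cdot> x\<bar> \<le> a \<cdot> v\<close> then has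
  nearly the same inner products, with \<open>a\<close> and also with \<open>b\<close>, as some grid point of this line,
  and there the two ridge functions agree. Comparing \<open>x\<close> with a point of the line avoids
  evaluating \<open>g\<close> at a multiple of \<open>b \<cdot> x\<close>, which might lie outside \<open>[-1, 1]\<close>.\<close>

lemma steep_profile:
  assumes g: "holder_gradient \<gamma> g g'" and h: "holder_gradient \<gamma> h h'" and \<gamma>: "0 < \<gamma>" "\<gamma> \<le> 1"
    and N: "0 < N" and d: "0 < d"
    and a: "\<eta> \<le> (\<Sum>i<d. \<bar>a i\<bar>)" "(\<Sum>i<d. \<bar>a i\<bar>) \<le> 1" and b: "(\<Sum>i<d. \<bar>b i\<bar>) \<le> 1" and \<eta>: "0 < \<eta>"
    and agree: "\<And>x. x \<in> sparse_grid d N (Suc s) \<Longrightarrow> g (ip d a x) = h (ip d b x)"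
    and line: "\<And>j. j \<in> {- int N..int N} \<Longrightarrow> (\<lambda>i\<in>{..<d}. real_of_int j / real N * v i) \<in> sparse_grid d N s"
    and v: "\<And>i. i < d \<Longrightarrow> \<bar>v i\<bar> \<le> 1" "0 < ip d a v"
    and j0: "j0 \<in> {- int N..int N}" and steep: "A < \<bar>g' (real_of_int j0 / real N * ip d a v)\<bar>"
    and A: "0 < A" "8 * (1 / real N) powr \<gamma> \<le> A * \<eta>"
    and x: "\<And>i. i < d \<Longrightarrow> \<bar>x i\<bar> \<le> 1" "\<bar>ip d a x\<bar> \<le> ip d a v"
  shows "\<bar>g (ip d a x) - h (ip d b x)\<bar> \<le> (3 / \<eta> + 16 / (\<eta> * A)) * (1 / real N) powr \<gamma>"
proof -
  define D where "D = (1 / real N) powr \<gamma>"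
  define pt where "pt = (\<lambda>j :: int. \<lambda>i\<in>{..<d}. real_of_int j / real N * v i)"
  have ip_pt: "ip d c (pt j) = real_of_int j / real N * ip d c v" for c j
    by (simp add: pt_def sum_distrib_left mult_ac)
  have pt: "pt j \<in> sparse_grid d N s" if "j \<in> {- int N..int N}" for j
    using line[OF that] by (simp add: pt_def)
  have pt_le: "\<bar>pt j i\<bar> \<le> 1" if "j \<in> {- int N..int N}" "i < d" for i j
    using cube_coordinate_le sparse_grid_subset_cube pt that by blast
  have "1 / real N \<le> (1 / real N) powr \<gamma>"
    using powr_mono'[of \<gamma> 1 "1 / real N"] \<gamma> N by (simp add: divide_le_eq_1)
  then have D: "1 / real N \<le> D" "0 \<le> D" by (simp_all add: D_def)
  define c where "c = g' (ip d a (pt j0))"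
  define e where "e = h' (ip d b (pt j0))"
  have c: "A < \<bar>c\<bar>" using steep by (simp add: c_def ip_pt)
  have grad: "(\<Sum>i<d. \<bar>c * a i - e * b i\<bar>) \<le> 4 * D"
    unfolding c_def e_def D_def
    by (rule agreeing_ridge_gradients[OF g h _ N a(2) b agree pt[OF j0] d]) (use \<gamma> in auto)
  have parallel: "\<bar>c * ip d a w - e * ip d b w\<bar> \<le> 4 * D" if "\<And>i. i < d \<Longrightarrow> \<bar>w i\<bar> \<le> 1" for w
  proof -
    have "c * ip d a w - e * ip d b w = ip d (\<lambda>i. c * a i - e * b i) w"
      by (simp add: sum_distrib_left sum_subtractf algebra_simps)
    with abs_ip_le[of d w "\<lambda>i. c * a i - e * b i"] that grad show ?thesis by simp
  qed
  \<comment> \<open>Since \<open>c a \<approx> e b\<close> and \<open>\<parallel>a\<parallel>\<^sub>1 \<ge> \<eta>\<close>, the factor \<open>e\<close> is bounded away from \<open>0\<close>, too.\<close>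
  have e: "\<bar>c\<bar> * \<eta> / 2 \<le> \<bar>e\<bar>"
  proof -
    have "\<bar>c\<bar> * \<eta> \<le> \<bar>c\<bar> * (\<Sum>i<d. \<bar>a i\<bar>)" using a by (intro mult_left_mono) auto
    also have "\<dots> = (\<Sum>i<d. \<bar>c * a i\<bar>)" by (simp add: sum_distrib_left abs_mult)
    also have "\<dots> \<le> (\<Sum>i<d. \<bar>c * a i - e * b i\<bar> + \<bar>e\<bar> * \<bar>b i\<bar>)"
    proof (intro sum_mono)
      show "\<bar>c * a i\<bar> \<le> \<bar>c * a i - e * b i\<bar> + \<bar>e\<bar> * \<bar>b i\<bar>" for i
        unfolding abs_mult[of e "b i", symmetric] by linarith
    qed
    also have "\<dots> \<le> 4 * D + \<bar>e\<bar> * (\<Sum>i<d. \<bar>b i\<bar>)"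
      using grad by (simp add: sum.distrib sum_distrib_left)
    also have "\<bar>e\<bar> * (\<Sum>i<d. \<bar>b i\<bar>) \<le> \<bar>e\<bar>" using b by (simp add: mult_left_le)
    finally have "\<bar>c\<bar> * \<eta> \<le> 4 * D + \<bar>e\<bar>" by simp
    moreover have "A * \<eta> \<le> \<bar>c\<bar> * \<eta>" using c \<eta> by simp
    ultimately show ?thesis using A(2) by (simp add: D_def)
  qed
  have a_v: "ip d a v \<le> 1" using abs_ip_le[of d v a] v(1) a(2) by auto
  from nearest_grid_multiple[OF N v(2) this x(2)] obtain j where
    j: "j \<in> {- int N..int N}" "\<bar>ip d a x - ip d a (pt j)\<bar> \<le> 1 / real N" by (auto simp: ip_pt)
  have pos: "0 < \<bar>c\<bar> * \<eta> / 2" using c A(1) \<eta> by simp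
  have "\<bar>e\<bar> * \<bar>ip d b x - ip d b (pt j)\<bar> = \<bar>e * ip d b x - e * ip d b (pt j)\<bar>"
    by (simp add: abs_mult[symmetric] algebra_simps)
  also have "\<dots> \<le> \<bar>c * ip d a x - c * ip d a (pt j)\<bar> + 8 * D"
    using parallel[of x, OF x(1)] parallel[of "pt j", OF pt_le[OF j(1)]] by linarith
  also have "\<bar>c * ip d a x - c * ip d a (pt j)\<bar> = \<bar>c\<bar> * \<bar>ip d a x - ip d a (pt j)\<bar>"
    by (simp add: abs_mult[symmetric] algebra_simps)
  also have "\<dots> \<le> \<bar>c\<bar> * D" using j(2) D by (intro mult_left_mono) auto
  finally have "\<bar>c\<bar> * \<eta> / 2 * \<bar>ip d b x - ip d b (pt j)\<bar> \<le> \<bar>c\<bar> * D + 8 * D"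
    using e mult_right_mono[OF e abs_ge_zero, of "ip d b x - ip d b (pt j)"] by linarith
  then have "\<bar>ip d b x - ip d b (pt j)\<bar> \<le> (\<bar>c\<bar> * D + 8 * D) / (\<bar>c\<bar> * \<eta> / 2)"
    using pos by (subst pos_le_divide_eq) (auto simp: mult.commute)
  also have "\<dots> = 2 / \<eta> * D + 16 / (\<eta> * \<bar>c\<bar>) * D"
  proof -
    have "c \<noteq> 0" using pos by auto
    then show ?thesis using \<eta> by (simp add: field_simps)
  qed
  also have "16 / (\<eta> * \<bar>c\<bar>) * D \<le> 16 / (\<eta> * A) * D"
    using c A(1) \<eta> D(2) by (intro mult_right_mono divide_left_mono mult_left_mono mult_pos_pos) auto
  finally have b_close: "\<bar>ip d b x - ip d b (pt j)\<bar> \<le> 2 / \<eta> * D + 16 / (\<eta> * A) * D" by simp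
  have "\<eta> \<le> 1" using a by simp
  then have "1 * D \<le> 1 / \<eta> * D" using \<eta> D(2) by (intro mult_right_mono) auto
  then have D_le: "D \<le> 1 / \<eta> * D" by simp
  have "\<bar>g (ip d a x) - g (ip d a (pt j))\<bar> \<le> \<bar>ip d a x - ip d a (pt j)\<bar>"
    by (rule holder_gradient_lipschitz[OF g ip_in_interval[OF a(2) x(1)] ip_in_interval[OF a(2) pt_le[OF j(1)]]])
  moreover have "\<bar>h (ip d b x) - h (ip d b (pt j))\<bar> \<le> \<bar>ip d b x - ip d b (pt j)\<bar>"
    by (rule holder_gradient_lipschitz[OF h ip_in_interval[OF b x(1)] ip_in_interval[OF b pt_le[OF j(1)]]])
  moreover have "g (ip d a (pt j)) = h (ip d b (pt j))"
    using agree pt[OF j(1)] sparse_grid_mono[OF d, of s "Suc s" N] by auto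
  ultimately have "\<bar>g (ip d a x) - h (ip d b x)\<bar> \<le> 1 / \<eta> * D + (2 / \<eta> * D + 16 / (\<eta> * A) * D)"
    using j(2) b_close D(1) D_le by linarith
  also have "\<dots> = (3 / \<eta> + 16 / (\<eta> * A)) * D" by (simp add: add_divide_distrib[symmetric] algebra_simps)
  finally show ?thesis by (simp add: D_def)
qed

text \<open>Either both profiles are flat on the ranges seen along their lines, and both functions are
  close to their common value at \<open>0\<close>, or one of them is steep somewhere and the weights are
  nearly proportional.\<close>

lemma agreeing_ridge_functions_inner:
  assumes g: "holder_gradient \<gamma> g g'" and h: "holder_gradient \<gamma> h h'" and \<gamma>: "0 < \<gamma>" "\<gamma> \<le> 1"
    and N: "0 < N" and d: "0 < d"
    and a: "\<eta> \<le> (\<Sum>i<d. \<bar>a i\<bar>)" "(\<Sum>i<d. \<bar>a i\<bar>) \<le> 1"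
    and b: "\<eta> \<le> (\<Sum>i<d. \<bar>b i\<bar>)" "(\<Sum>i<d. \<bar>b i\<bar>) \<le> 1" and \<eta>: "0 < \<eta>"
    and agree: "\<And>x. x \<in> sparse_grid d N (Suc s) \<Longrightarrow> g (ip d a x) = h (ip d b x)"
    and line_v: "\<And>j. j \<in> {- int N..int N} \<Longrightarrow> (\<lambda>i\<in>{..<d}. real_of_int j / real N * v i) \<in> sparse_grid d N s"
    and v: "\<And>i. i < d \<Longrightarrow> \<bar>v i\<bar> \<le> 1" "0 < ip d a v"
    and line_v': "\<And>j. j \<in> {- int N..int N} \<Longrightarrow> (\<lambda>i\<in>{..<d}. real_of_int j / real N * v' i) \<in> sparse_grid d N s"
    and v': "\<And>i. i < d \<Longrightarrow> \<bar>v' i\<bar> \<le> 1" "0 < ip d b v'"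
    and \<kappa>: "0 < \<kappa>" "\<kappa> \<le> 1" and N_large: "(1 / real N) powr \<gamma> \<le> \<eta> * \<kappa>\<^sup>2 / 100"
    and x: "\<And>i. i < d \<Longrightarrow> \<bar>x i\<bar> \<le> 1" "\<bar>ip d a x\<bar> \<le> ip d a v" "\<bar>ip d b x\<bar> \<le> ip d b v'"
  shows "\<bar>g (ip d a x) - h (ip d b x)\<bar> \<le> \<kappa>"
proof -
  define D where "D = (1 / real N) powr \<gamma>"
  have \<eta>1: "\<eta> \<le> 1" using a by simp
  have \<kappa>2: "\<kappa>\<^sup>2 \<le> \<kappa>" using \<kappa> by (simp add: power2_eq_square mult_left_le)
  have "\<eta> * \<kappa>\<^sup>2 \<le> 1 * \<kappa>\<^sup>2" using \<eta>1 by (intro mult_right_mono) auto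
  moreover have "\<eta> * \<kappa>\<^sup>2 \<le> \<eta> * \<kappa>" using \<eta> \<kappa>2 by (intro mult_left_mono) auto
  moreover have "0 \<le> D" by (simp add: D_def)
  moreover have "D \<le> \<eta> * \<kappa>\<^sup>2 / 100" using N_large by (simp add: D_def)
  moreover have "\<kappa> / 4 * \<eta> = \<eta> * \<kappa> / 4" by simp
  ultimately have D: "D \<le> \<kappa> / 100" "8 * D \<le> \<kappa> / 4 * \<eta>" "0 \<le> D" "D \<le> \<eta> * \<kappa>\<^sup>2 / 100"
    using \<kappa>2 by linarith+
  \<comment> \<open>With the threshold \<open>\<kappa> / 4\<close> between flat and steep, \<open>\<eta> * \<kappa>\<^sup>2 / 100\<close> is a resolution at which both
    cases give \<open>\<kappa>\<close>.\<close>
  have "(3 / \<eta> + 16 / (\<eta> * (\<kappa> / 4))) * D \<le> (3 / \<eta> + 16 / (\<eta> * (\<kappa> / 4))) * (\<eta> * \<kappa>\<^sup>2 / 100)"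
    using D \<eta> \<kappa> by (intro mult_left_mono) auto
  also have "\<dots> = 3 / 100 * \<kappa>\<^sup>2 + 64 / 100 * \<kappa>" using \<eta> \<kappa> by (simp add: field_simps power2_eq_square)
  also have "\<dots> \<le> \<kappa>" using \<kappa>2 \<kappa> by linarith
  finally have steep_bound: "(3 / \<eta> + 16 / (\<eta> * (\<kappa> / 4))) * D \<le> \<kappa>" .
  consider
    (flat) "\<And>j. j \<in> {- int N..int N} \<Longrightarrow> \<bar>g' (real_of_int j / real N * ip d a v)\<bar> \<le> \<kappa> / 4"
      "\<And>j. j \<in> {- int N..int N} \<Longrightarrow> \<bar>h' (real_of_int j / real N * ip d b v')\<bar> \<le> \<kappa> / 4"
  | (steep_g) j where "j \<in> {- int N..int N}" "\<kappa> / 4 < \<bar>g' (real_of_int j / real N * ip d a v)\<bar>"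
  | (steep_h) j where "j \<in> {- int N..int N}" "\<kappa> / 4 < \<bar>h' (real_of_int j / real N * ip d b v')\<bar>"
    by force
  then show ?thesis
  proof cases
    case flat
    have le1: "ip d a v \<le> 1" "ip d b v' \<le> 1"
      using abs_ip_le[of d v a] abs_ip_le[of d v' b] v(1) v'(1) a(2) b(2) by auto
    have "\<bar>g (ip d a x) - g 0\<bar> \<le> \<kappa> / 4 + 2 * D"
      unfolding D_def by (rule flat_profile[OF g _ N v(2) le1(1) flat(1) x(2)]) (use \<gamma> in auto)
    moreover have "\<bar>h (ip d b x) - h 0\<bar> \<le> \<kappa> / 4 + 2 * D"
      unfolding D_def by (rule flat_profile[OF h _ N v'(2) le1(2) flat(2) x(3)]) (use \<gamma> in auto)
    moreover have "g 0 = h 0"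
    proof -
      have "(\<lambda>i\<in>{..<d}. 0) \<in> sparse_grid d N (Suc s)"
        using sparse_grid_mono[OF d, of 0 "Suc s" N] by auto
      from agree[OF this] show ?thesis by simp
    qed
    ultimately show ?thesis using D by linarith
  next
    case steep_g
    have "\<bar>g (ip d a x) - h (ip d b x)\<bar> \<le> (3 / \<eta> + 16 / (\<eta> * (\<kappa> / 4))) * D"
      unfolding D_def
      by (rule steep_profile[OF g h \<gamma> N d a b(2) \<eta> agree line_v v steep_g _ _ x(1,2)])
        (use \<kappa> D in \<open>auto simp: D_def\<close>)
    with steep_bound show ?thesis by linarith
  next
    case steep_h
    have "\<bar>h (ip d b x) - g (ip d a x)\<bar> \<le> (3 / \<eta> + 16 / (\<eta> * (\<kappa> / 4))) * D"
      unfolding D_def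
      by (rule steep_profile[OF h g \<gamma> N d b a(2) \<eta> agree[symmetric] line_v' v' steep_h _ _ x(1,3)])
        (use \<kappa> D in \<open>auto simp: D_def\<close>)
    with steep_bound show ?thesis by linarith
  qed
qed

section \<open>Weights of small lp quasi-norm\<close>

lemma sum_powr_le_1:
  assumes p: "0 < p" and a: "lp_norm d p a \<le> 1"
  shows "(\<Sum>i<d. \<bar>a i\<bar> powr p) \<le> 1"
proof (rule ccontr)
  assume "\<not> ?thesis"
  then have "1 < lp_norm d p a" unfolding lp_norm_def using p by (intro gr_one_powr) auto
  with a show False by simp
qed

lemma l1_norm_le_1:
  fixes a :: "nat \<Rightarrow> real"
  assumes p: "0 < p" "p < 1" and a: "(\<Sum>i<d. \<bar>a i\<bar> powr p) \<le> 1"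
  shows "(\<Sum>i<d. \<bar>a i\<bar>) \<le> 1"
proof -
  have "\<bar>a i\<bar> \<le> \<bar>a i\<bar> powr p" if "i < d" for i
  proof -
    have "\<bar>a i\<bar> powr p \<le> (\<Sum>i<d. \<bar>a i\<bar> powr p)" using that by (intro member_le_sum) auto
    with a have "\<bar>a i\<bar> powr p \<le> 1 powr p" by simp
    then have "\<bar>a i\<bar> \<le> 1" using p powr_less_mono2[of p 1 "\<bar>a i\<bar>"] by linarith
    then show ?thesis using powr_mono'[of p 1 "\<bar>a i\<bar>"] p by simp
  qed
  then have "(\<Sum>i<d. \<bar>a i\<bar>) \<le> (\<Sum>i<d. \<bar>a i\<bar> powr p)" by (intro sum_mono) auto
  with a show ?thesis by simp
qed

text \<open>Each coordinate above \<open>\<theta>\<close> contributes more than \<open>\<theta> powr p\<close> to the sum of the \<open>p\<close>-th powers,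
  and each of the others is at most \<open>\<theta> powr (1 - p)\<close> times its \<open>p\<close>-th power.\<close>

lemma few_large_coordinates:
  fixes a :: "nat \<Rightarrow> real"
  assumes p: "0 < p" "p < 1" and a: "(\<Sum>i<d. \<bar>a i\<bar> powr p) \<le> 1" and \<theta>: "0 < \<theta>"
  defines "U \<equiv> {i. i < d \<and> \<theta> < \<bar>a i\<bar>}"
  shows "real (card U) \<le> \<theta> powr (- p)" and "(\<Sum>i\<in>{..<d} - U. \<bar>a i\<bar>) \<le> \<theta> powr (1 - p)"
proof -
  have "real (card U) * \<theta> powr p = (\<Sum>i\<in>U. \<theta> powr p)" by simp
  also have "\<dots> \<le> (\<Sum>i\<in>U. \<bar>a i\<bar> powr p)"
    using p \<theta> by (intro sum_mono powr_mono2) (auto simp: U_def)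
  also have "\<dots> \<le> (\<Sum>i<d. \<bar>a i\<bar> powr p)" by (intro sum_mono2) (auto simp: U_def)
  finally have "real (card U) * \<theta> powr p \<le> 1" using a by simp
  then show "real (card U) \<le> \<theta> powr (- p)" using \<theta> by (simp add: powr_minus_divide field_simps)
  have "\<bar>a i\<bar> \<le> \<bar>a i\<bar> powr p * \<theta> powr (1 - p)" if "i \<in> {..<d} - U" for i
  proof -
    have "\<bar>a i\<bar> = \<bar>a i\<bar> powr p * \<bar>a i\<bar> powr (1 - p)" by (simp add: powr_add[symmetric])
    also have "\<dots> \<le> \<bar>a i\<bar> powr p * \<theta> powr (1 - p)"
      using p that by (intro mult_left_mono powr_mono2) (auto simp: U_def)
    finally show ?thesis .
  qed
  then have "(\<Sum>i\<in>{..<d} - U. \<bar>a i\<bar>) \<le> (\<Sum>i\<in>{..<d} - U. \<bar>a i\<bar> powr p * \<theta> powr (1 - p))"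
    by (intro sum_mono) auto
  also have "\<dots> = (\<Sum>i\<in>{..<d} - U. \<bar>a i\<bar> powr p) * \<theta> powr (1 - p)" by (simp add: sum_distrib_right)
  also have "(\<Sum>i\<in>{..<d} - U. \<bar>a i\<bar> powr p) \<le> (\<Sum>i<d. \<bar>a i\<bar> powr p)" by (intro sum_mono2) auto
  then have "(\<Sum>i\<in>{..<d} - U. \<bar>a i\<bar> powr p) * \<theta> powr (1 - p) \<le> 1 * \<theta> powr (1 - p)"
    using a by (intro mult_right_mono) auto
  finally show "(\<Sum>i\<in>{..<d} - U. \<bar>a i\<bar>) \<le> \<theta> powr (1 - p)" by simp
qed

text \<open>The signs of \<open>a\<close> at its large coordinates give a sparse vector \<open>v\<close> with \<open>a \<cdot> v\<close> close to
  the maximum \<open>\<parallel>a\<parallel>\<^sub>1\<close> of \<open>a \<cdot> x\<close> over the cube. The line through such a \<open>v\<close> sees all of the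
  profile except for a relative portion \<open>l\<close> at each end.\<close>

lemma sparse_sign_vector:
  assumes p: "0 < p" "p < 1" and a: "(\<Sum>i<d. \<bar>a i\<bar> powr p) \<le> 1" and \<eta>: "0 < \<eta>" "\<eta> \<le> (\<Sum>i<d. \<bar>a i\<bar>)"
    and l: "0 < l" "l < 1" and s: "(\<eta> * l) powr (- (p / (1 - p))) \<le> real s" and d: "0 < d"
  obtains v where
    "\<And>j. j \<in> {- int N..int N} \<Longrightarrow> (\<lambda>i\<in>{..<d}. real_of_int j / real N * v i) \<in> sparse_grid d N s"
    "\<And>i. i < d \<Longrightarrow> \<bar>v i\<bar> \<le> 1" "0 < ip d a v" "(1 - l) * (\<Sum>i<d. \<bar>a i\<bar>) \<le> ip d a v"
proof -
  \<comment> \<open>The threshold for which the small coordinates have \<open>\<ell>\<^sub>1\<close>-norm at most \<open>\<eta> * l\<close>.\<close>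
  define \<theta> where "\<theta> = (\<eta> * l) powr (1 / (1 - p))"
  define U where "U = {i. i < d \<and> \<theta> < \<bar>a i\<bar>}"
  define \<sigma> :: "nat \<Rightarrow> int" where "\<sigma> = (\<lambda>i. if a i < 0 then -1 else 1)"
  define v where "v = (\<lambda>i. if i \<in> U then real_of_int (\<sigma> i) else 0)"
  have \<theta>: "0 < \<theta>" using \<eta> l by (simp add: \<theta>_def)
  note large = few_large_coordinates[OF p a \<theta>, folded U_def]
  have "real (card U) \<le> real s"
    using large(1) s by (simp add: \<theta>_def powr_powr)
  then have card: "card U \<le> s" by simp
  have U: "finite U" "U \<subseteq> {..<d}" by (auto simp: U_def)
  have "(\<lambda>i\<in>{..<d}. real_of_int j / real N * v i) \<in> sparse_grid d N s" if j: "j \<in> {- int N..int N}" for j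
  proof -
    have "(\<lambda>i\<in>{..<d}. if i \<in> U then real_of_int (\<sigma> i * j) / real N else 0) \<in> sparse_grid d N (card U)"
      by (rule scaled_sign_vector_in_sparse_grid[OF U _ j]) (simp add: \<sigma>_def)
    also have "(\<lambda>i\<in>{..<d}. if i \<in> U then real_of_int (\<sigma> i * j) / real N else 0)
        = (\<lambda>i\<in>{..<d}. real_of_int j / real N * v i)" by (intro restrict_ext) (simp add: v_def)
    finally show ?thesis using sparse_grid_mono[OF d card] by blast
  qed
  moreover have "\<bar>v i\<bar> \<le> 1" for i by (simp add: v_def \<sigma>_def)
  moreover have le: "(1 - l) * (\<Sum>i<d. \<bar>a i\<bar>) \<le> ip d a v"
  proof -
    have "ip d a v = (\<Sum>i<d. if i \<in> U then \<bar>a i\<bar> else 0)"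
      by (intro sum.cong) (auto simp: v_def \<sigma>_def)
    also have "\<dots> = (\<Sum>i\<in>U. \<bar>a i\<bar>)" using U(2) by (simp add: sum.inter_restrict[symmetric] Int_absorb1)
    also have "\<dots> = (\<Sum>i<d. \<bar>a i\<bar>) - (\<Sum>i\<in>{..<d} - U. \<bar>a i\<bar>)"
      using U(2) by (simp add: sum_diff)
    finally have eq: "ip d a v = (\<Sum>i<d. \<bar>a i\<bar>) - (\<Sum>i\<in>{..<d} - U. \<bar>a i\<bar>)" .
    have "(\<Sum>i\<in>{..<d} - U. \<bar>a i\<bar>) \<le> \<eta> * l"
      using large(2) p \<eta> l by (simp add: \<theta>_def powr_powr)
    also have "\<eta> * l \<le> (\<Sum>i<d. \<bar>a i\<bar>) * l" using \<eta> l by (intro mult_right_mono) auto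
    finally show ?thesis unfolding eq by (simp add: algebra_simps)
  qed
  moreover have "0 < (1 - l) * (\<Sum>i<d. \<bar>a i\<bar>)" using l \<eta> by simp
  then have "0 < ip d a v" using le by linarith
  ultimately show thesis using that by blast
qed

section \<open>Ridge functions are determined by sparse samples\<close>

text \<open>The inner estimate leaves out the points with \<open>\<bar>a \<cdot> x\<bar>\<close> or \<open>\<bar>b \<cdot> x\<bar>\<close> near the maximum.
  They are reached along the ray from \<open>0\<close> through \<open>x\<close>: on it the difference \<open>w 0 u = g (u * (a \<cdot>
  x)) - h (u * (b \<cdot> x))\<close> is small for \<open>u \<le> 1 - l\<close>, and it is smooth of order \<open>r\<close>, so that it can
  be extrapolated to \<open>u = 1\<close>.\<close>

lemma agreeing_ridge_functions_close:
  assumes r: "1 < r" and g: "g \<in> lip_ball r" and h: "h \<in> lip_ball r"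
    and p: "0 < p" "p < 1" and d: "0 < d" and N: "0 < N"
    and a: "\<eta> \<le> (\<Sum>i<d. \<bar>a i\<bar>)" "(\<Sum>i<d. \<bar>a i\<bar> powr p) \<le> 1"
    and b: "\<eta> \<le> (\<Sum>i<d. \<bar>b i\<bar>)" "(\<Sum>i<d. \<bar>b i\<bar> powr p) \<le> 1" and \<eta>: "0 < \<eta>"
    and l: "0 < l" "2 * l \<le> 1" and s: "(\<eta> * l) powr (- (p / (1 - p))) \<le> real s"
    and \<kappa>: "0 < \<kappa>" "\<kappa> \<le> 1" and N_large: "(1 / real N) powr min 1 (r - 1) \<le> \<eta> * \<kappa>\<^sup>2 / 100"
    and agree: "\<And>x. x \<in> sparse_grid d N (Suc s) \<Longrightarrow> g (ip d a x) = h (ip d b x)"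
    and x: "\<And>i. i < d \<Longrightarrow> \<bar>x i\<bar> \<le> 1"
  defines "m \<equiv> smooth_order r"
  shows "\<bar>g (ip d a x) - h (ip d b x)\<bar> \<le> real (Suc m) * (\<kappa> * (2 * 3 ^ m / l) ^ m) + 4 * (2 * l) powr r"
proof -
  note m = smooth_order_bounds[OF r, folded m_def]
  note G = lip_ball_derivatives[OF g, folded m_def] and H = lip_ball_derivatives[OF h, folded m_def]
  define \<beta> where "\<beta> = r - real m"
  have \<beta>: "0 < \<beta>" "r = \<beta> + real m" using m by (auto simp: \<beta>_def)
  have a1: "(\<Sum>i<d. \<bar>a i\<bar>) \<le> 1" and b1: "(\<Sum>i<d. \<bar>b i\<bar>) \<le> 1"
    using l1_norm_le_1[OF p] a(2) b(2) by auto
  have l1: "l < 1" using l by simp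
  obtain v where v:
    "\<And>j. j \<in> {- int N..int N} \<Longrightarrow> (\<lambda>i\<in>{..<d}. real_of_int j / real N * v i) \<in> sparse_grid d N s"
    "\<And>i. i < d \<Longrightarrow> \<bar>v i\<bar> \<le> 1" "0 < ip d a v" "(1 - l) * (\<Sum>i<d. \<bar>a i\<bar>) \<le> ip d a v"
    using sparse_sign_vector[OF p a(2) \<eta> a(1) l(1) l1 s d] by blast
  obtain v' where v':
    "\<And>j. j \<in> {- int N..int N} \<Longrightarrow> (\<lambda>i\<in>{..<d}. real_of_int j / real N * v' i) \<in> sparse_grid d N s"
    "\<And>i. i < d \<Longrightarrow> \<bar>v' i\<bar> \<le> 1" "0 < ip d b v'" "(1 - l) * (\<Sum>i<d. \<bar>b i\<bar>) \<le> ip d b v'"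
    using sparse_sign_vector[OF p b(2) \<eta> b(1) l(1) l1 s d] by blast
  define y where "y = ip d a x"
  define y' where "y' = ip d b x"
  have y: "\<bar>y\<bar> \<le> (\<Sum>i<d. \<bar>a i\<bar>)" "\<bar>y'\<bar> \<le> (\<Sum>i<d. \<bar>b i\<bar>)"
    unfolding y_def y'_def by (intro abs_ip_le x; assumption)+
  then have y1: "\<bar>y\<bar> \<le> 1" "\<bar>y'\<bar> \<le> 1" using a1 b1 by linarith+
  have in_I: "u * t \<in> {-1..1}" if "\<bar>t\<bar> \<le> 1" "u \<in> {-1..1}" for t u :: real
  proof -
    have "\<bar>u * t\<bar> \<le> 1 * 1" using that unfolding abs_mult by (intro mult_mono) auto
    then show ?thesis unfolding atLeastAtMost_iff by linarith
  qed
  define w where "w = (\<lambda>k u. y ^ k * nth_deriv k g (u * y) - y' ^ k * nth_deriv k h (u * y'))"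
  have scaled_derivative: "((\<lambda>u. t ^ k * f k (u * t)) has_real_derivative t ^ Suc k * f (Suc k) (u * t))
      (at u within {-1..1})"
    if f: "\<And>z. z \<in> {-1..1} \<Longrightarrow> (f k has_real_derivative f (Suc k) z) (at z within {-1..1})"
      and t: "\<bar>t\<bar> \<le> 1" and u: "u \<in> {-1..1}" for f :: "nat \<Rightarrow> real \<Rightarrow> real" and t u k
  proof -
    have "((f k \<circ> (\<lambda>u. u * t)) has_real_derivative f (Suc k) (u * t) * t) (at u within {-1..1})"
    proof (rule DERIV_image_chain)
      show "(f k has_real_derivative f (Suc k) (u * t)) (at (u * t) within (\<lambda>u. u * t) ` {-1..1})"
        using f[OF in_I[OF t u]] by (rule DERIV_subset) (use in_I[OF t] in blast)
      show "((\<lambda>u. u * t) has_real_derivative t) (at u within {-1..1})"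
        by (auto intro!: derivative_eq_intros)
    qed
    from DERIV_cmult[OF this, of "t ^ k"] show ?thesis by (simp add: o_def mult_ac)
  qed
  have scaled_holder: "\<bar>t ^ m * f (u * t) - t ^ m * f (u' * t)\<bar> \<le> 2 * \<bar>u - u'\<bar> powr \<beta>"
    if f: "\<And>z z'. z \<in> {-1..1} \<Longrightarrow> z' \<in> {-1..1} \<Longrightarrow> \<bar>f z - f z'\<bar> \<le> 2 * \<bar>z - z'\<bar> powr \<beta>"
      and t: "\<bar>t\<bar> \<le> 1" and u: "u \<in> {-1..1}" "u' \<in> {-1..1}" for f :: "real \<Rightarrow> real" and t u u'
  proof -
    have "\<bar>t ^ m * f (u * t) - t ^ m * f (u' * t)\<bar> = \<bar>t\<bar> ^ m * \<bar>f (u * t) - f (u' * t)\<bar>"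
      by (simp add: power_abs[symmetric] abs_mult[symmetric] algebra_simps)
    also have "\<dots> \<le> 1 * \<bar>f (u * t) - f (u' * t)\<bar>"
      using t by (intro mult_right_mono power_le_one) auto
    also have "\<dots> \<le> 2 * \<bar>u * t - u' * t\<bar> powr \<beta>" using f[OF in_I[OF t u(1)] in_I[OF t u(2)]] by simp
    also have "\<bar>u * t - u' * t\<bar> = \<bar>u - u'\<bar> * \<bar>t\<bar>" by (simp add: abs_mult[symmetric] algebra_simps)
    also have "2 * (\<bar>u - u'\<bar> * \<bar>t\<bar>) powr \<beta> \<le> 2 * \<bar>u - u'\<bar> powr \<beta>"
      using t \<beta>(1) by (intro mult_left_mono powr_mono2 mult_left_le) auto
    finally show ?thesis .
  qed
  have "\<bar>w 0 1\<bar> \<le> real (Suc m) * (\<kappa> * (2 * 3 ^ m / l) ^ m) + 4 * (2 * l) powr (\<beta> + real m)"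
  proof (rule small_values_extrapolate[where w = w and u = 1 and I = "{-1..1}" and c = "1 - 2 * l"])
    show "(w k has_real_derivative w (Suc k) u) (at u within {-1..1})"
      if "k < m" "u \<in> {-1..1}" for k u
      using scaled_derivative[where f = "\<lambda>k. nth_deriv k g" and k = k, OF G(1)[OF that(1)] y1(1) that(2)]
        scaled_derivative[where f = "\<lambda>k. nth_deriv k h" and k = k, OF H(1)[OF that(1)] y1(2) that(2)]
      unfolding w_def by (rule DERIV_diff)
    show "\<bar>w m u - w m u'\<bar> \<le> 4 * \<bar>u - u'\<bar> powr \<beta>" if u: "u \<in> {-1..1}" "u' \<in> {-1..1}" for u u'
    proof -
      have "\<bar>nth_deriv m g z - nth_deriv m g z'\<bar> \<le> 2 * \<bar>z - z'\<bar> powr \<beta>"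
        "\<bar>nth_deriv m h z - nth_deriv m h z'\<bar> \<le> 2 * \<bar>z - z'\<bar> powr \<beta>"
        if "z \<in> {-1..1}" "z' \<in> {-1..1}" for z z'
        using G(3)[OF that] H(3)[OF that] \<beta>(1) by (auto simp: \<beta>_def)
      from scaled_holder[where f = "nth_deriv m g", OF this(1) y1(1) u]
        scaled_holder[where f = "nth_deriv m h", OF this(2) y1(2) u]
      show ?thesis unfolding w_def by linarith
    qed
    show "\<bar>w 0 u\<bar> \<le> \<kappa>" if u: "u \<in> {1 - 2 * l..1 - 2 * l + l}" for u
    proof -
      have u: "0 \<le> u" "u \<le> 1 - l" using u l by auto
      have scaled: "ip d c (\<lambda>i. u * x i) = u * ip d c x" for c by (simp add: sum_distrib_left mult_ac)
      have "\<bar>u * y\<bar> \<le> (1 - l) * (\<Sum>i<d. \<bar>a i\<bar>)" "\<bar>u * y'\<bar> \<le> (1 - l) * (\<Sum>i<d. \<bar>b i\<bar>)"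
        unfolding abs_mult using u y l by (intro mult_mono; simp)+
      then have "\<bar>ip d a (\<lambda>i. u * x i)\<bar> \<le> ip d a v" "\<bar>ip d b (\<lambda>i. u * x i)\<bar> \<le> ip d b v'"
        unfolding scaled y_def[symmetric] y'_def[symmetric] using v(4) v'(4) by linarith+
      moreover have "\<bar>u * x i\<bar> \<le> 1" if "i < d" for i
        using u l x[OF that] unfolding abs_mult by (intro mult_le_one) auto
      ultimately have "\<bar>g (ip d a (\<lambda>i. u * x i)) - h (ip d b (\<lambda>i. u * x i))\<bar> \<le> \<kappa>"
        by (intro agreeing_ridge_functions_inner[OF lip_ball_holder_gradient[OF g r]
              lip_ball_holder_gradient[OF h r] _ _ N d a(1) a1 b(1) b1 \<eta> agree v(1-3) v'(1-3) \<kappa> N_large])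
          (use r in auto)
      then show ?thesis by (simp add: scaled w_def y_def y'_def nth_deriv_def)
    qed
  qed (use l \<beta> in auto)
  then show ?thesis by (simp add: w_def y_def y'_def nth_deriv_def \<beta>(2))
qed

text \<open>The choice of parameters for accuracy \<open>1/z\<close>. The unseen portion \<open>l\<close> must be of order \<open>z
  powr (-1/r)\<close> to keep the extrapolation error below \<open>1/z\<close>; this forces a sparsity of order \<open>z
  powr (p/(1-p)/r)\<close>, the only quantity that enters the exponent. All other tolerances are powers
  of \<open>1/z\<close> and cost no more than a logarithm.\<close>

lemma ridge_class_sampling_bound:
  assumes p: "0 < p" "p < 1" and r: "1 < r" and S: "1 \<le> S"
  defines "\<theta> \<equiv> p / (1 - p) / r"
  shows "\<exists>A>0. \<exists>B>0. \<exists>K>0. \<forall>z\<ge>1. \<forall>d. 0 < d \<longrightarrow> real d \<le> z \<longrightarrow>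
    (\<exists>n\<ge>1. err n d (ridge_class r p S d) \<le> ereal (1 / z) \<and>
      ln (real n) \<le> (A * z powr \<theta> + 2) * ln (z * (2 * (B * z powr K) + 3)))"
proof -
  define q where "q = p / (1 - p)"
  have q: "0 < q" using p by (simp add: q_def)
  define \<eta> where "\<eta> = min 1 (4 * real S powr (1 - 1 / p))"
  have \<eta>: "0 < \<eta>" using S by (simp add: \<eta>_def)
  define m where "m = smooth_order r"
  define \<gamma> where "\<gamma> = min 1 (r - 1)"
  have \<gamma>: "0 < \<gamma>" "\<gamma> \<le> 1" using r by (auto simp: \<gamma>_def)
  \<comment> \<open>The constant is such that \<open>\<kappa> = c / z ^ Suc m\<close>, multiplied by the amplification factor of the
    extrapolation lemma, is at most \<open>1 / (2 * z)\<close>; here \<open>1 / l \<le> 16 * z\<close> enters.\<close>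
  define c where "c = 1 / (2 * real (Suc m) * (32 * 3 ^ m) ^ m)"
  have "1 \<le> (3 :: real) ^ m" by simp
  then have "1 \<le> (32 * 3 ^ m :: real) ^ m" by (intro one_le_power) linarith
  then have c: "0 < c" "c \<le> 1"
    using mult_mono[of 1 "2 * real (Suc m)" 1 "(32 * 3 ^ m :: real) ^ m"] by (auto simp: c_def)
  define A where "A = (\<eta> / 2) powr (- q) * 8 powr \<theta>"
  define B where "B = (\<eta> * c\<^sup>2 / 100) powr (- 1 / \<gamma>)"
  define K where "K = real (2 * Suc m) / \<gamma>"
  have pos: "0 < A" "0 < B" "0 < K" using \<eta> c \<gamma> by (auto simp: A_def B_def K_def)
  have "\<exists>n\<ge>1. err n d (ridge_class r p S d) \<le> ereal (1 / z) \<and>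
      ln (real n) \<le> (A * z powr \<theta> + 2) * ln (z * (2 * (B * z powr K) + 3))"
    if z: "1 \<le> z" and d: "0 < d" "real d \<le> z" for z :: real and d
  proof -
    \<comment> \<open>So that \<open>4 * (2 * l) powr r = 1 / (2 * z)\<close>.\<close>
    define l where "l = (1 / (8 * z)) powr (1 / r) / 2"
    define \<kappa> where "\<kappa> = c / z ^ Suc m"
    define s where "s = nat \<lceil>(\<eta> * l) powr (- q)\<rceil>"
    define M where "M = (\<eta> * \<kappa>\<^sup>2 / 100) powr (- 1 / \<gamma>)"
    define N where "N = nat \<lceil>M\<rceil>"
    have \<kappa>: "0 < \<kappa>" "\<kappa> \<le> 1"
      using c z order_trans[OF c(2) one_le_power[OF z, of "Suc m"]]
      by (auto simp: \<kappa>_def divide_le_eq simp del: power_Suc)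
    have l0: "0 < l" using z by (simp add: l_def)
    have l1: "2 * l \<le> 1" using z r powr_le1[of "1 / r" "1 / (8 * z)"] by (simp add: l_def divide_le_eq)
    have l_pow: "4 * (2 * l) powr r = 1 / z / 2" using z r by (simp add: l_def powr_powr)
    have l_inv: "1 / l \<le> 16 * z"
    proof -
      have "1 / (8 * z) \<le> (1 / (8 * z)) powr (1 / r)"
        using powr_mono'[of "1 / r" 1 "1 / (8 * z)"] r z by (simp add: divide_le_eq)
      then have "1 / (16 * z) \<le> l" using z by (simp add: l_def)
      then show ?thesis using z l0 by (simp add: field_simps)
    qed
    have "real (Suc m) * (\<kappa> * (2 * 3 ^ m / l) ^ m) = real (Suc m) * (\<kappa> * (2 * 3 ^ m * (1 / l)) ^ m)"
      by simp
    also have "\<dots> \<le> real (Suc m) * (\<kappa> * (2 * 3 ^ m * (16 * z)) ^ m)"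
      using l_inv l0 \<kappa> z by (intro mult_left_mono power_mono) auto
    also have "\<dots> = real (Suc m) * (\<kappa> * ((32 * 3 ^ m) ^ m * z ^ m))"
    proof -
      have "2 * 3 ^ m * (16 * z) = (32 * 3 ^ m) * z" by simp
      then show ?thesis by (simp only: power_mult_distrib)
    qed
    also have "\<dots> = 1 / z / 2"
    proof -
      have "k * (1 / (2 * k * Q) / (z * Z) * (Q * Z)) = 1 / z / 2"
        if "0 < k" "0 < Q" "0 < Z" for k Q Z :: real
        using that z by (simp add: field_simps)
      from this[of "real (Suc m)" "(32 * 3 ^ m) ^ m" "z ^ m"] z show ?thesis
        by (simp add: \<kappa>_def c_def)
    qed
    finally have extrapolation_error:
      "real (Suc m) * (\<kappa> * (2 * 3 ^ m / l) ^ m) + 4 * (2 * l) powr r \<le> 1 / z"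
      unfolding l_pow by simp
    have M: "0 < M" using \<eta> \<kappa> by (simp add: M_def)
    then have N: "0 < N" "M \<le> real N" "real N \<le> M + 1" unfolding N_def by linarith+
    have "(1 / real N) powr \<gamma> \<le> (1 / M) powr \<gamma>"
      using M N \<gamma> by (intro powr_mono2 divide_left_mono) auto
    also have "\<dots> = \<eta> * \<kappa>\<^sup>2 / 100"
      using \<eta> \<kappa> \<gamma> by (simp add: M_def powr_minus_divide powr_powr)
    finally have N_large: "(1 / real N) powr min 1 (r - 1) \<le> \<eta> * \<kappa>\<^sup>2 / 100" by (simp add: \<gamma>_def)
    have s: "(\<eta> * l) powr (- (p / (1 - p))) \<le> real s" unfolding s_def q_def by linarith
    let ?X = "sparse_grid d N (Suc s)"
    have weights: "(\<Sum>i<d. \<bar>a i\<bar> powr p) \<le> 1" if "lp_norm d p a \<le> 1" for a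
      using sum_powr_le_1[OF p(1) that] .
    have "err (card ?X) d (ridge_class r p S d) \<le> ereal (1 / z)"
    proof (rule err_le_if_determined_by_samples[OF finite_sparse_grid sparse_grid_subset_cube])
      show "ridge_class r p S d \<subseteq> cont_funs d"
      proof (rule ridge_class_subset_cont_funs)
        show "continuous_on {-1..1} g" if "g \<in> lip_ball r" for g
          using lip_ball_holder_gradient[OF that r]
          by (intro DERIV_continuous_on) (auto simp: holder_gradient_def)
      qed (use weights l1_norm_le_1[OF p] in blast)
      fix f f' x
      assume f: "f \<in> ridge_class r p S d" "f' \<in> ridge_class r p S d"
        and agree: "\<forall>y\<in>?X. f y = f' y" and x: "x \<in> cube d"
      from f(1) obtain g a where a: "f = restrict (\<lambda>x. g (ip d a x)) (cube d)" "g \<in> lip_ball r"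
        "lp_norm d p a \<le> 1" "\<eta> \<le> lp_norm d 1 a" unfolding ridge_class_def \<eta>_def by blast
      from f(2) obtain h b where b: "f' = restrict (\<lambda>x. h (ip d b x)) (cube d)" "h \<in> lip_ball r"
        "lp_norm d p b \<le> 1" "\<eta> \<le> lp_norm d 1 b" unfolding ridge_class_def \<eta>_def by blast
      have l1_norm: "lp_norm d 1 e = (\<Sum>i<d. \<bar>e i\<bar>)" for e
        by (simp add: lp_norm_def sum_nonneg)
      have agree: "g (ip d a y) = h (ip d b y)" if "y \<in> ?X" for y
        using bspec[OF agree that] subsetD[OF sparse_grid_subset_cube that] by (simp add: a(1) b(1))
      have "\<bar>g (ip d a x) - h (ip d b x)\<bar> \<le>
          real (Suc m) * (\<kappa> * (2 * 3 ^ m / l) ^ m) + 4 * (2 * l) powr r"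
        unfolding m_def
        by (rule agreeing_ridge_functions_close[OF r a(2) b(2) p d(1) N(1) _ weights[OF a(3)] _
              weights[OF b(3)] \<eta> l0 l1 s \<kappa> N_large agree cube_coordinate_le[OF x]])
          (use a(4) b(4) in \<open>simp_all add: l1_norm\<close>)
      with extrapolation_error show "\<bar>f x - f' x\<bar> \<le> 1 / z" using x by (simp add: a(1) b(1))
    qed
    moreover have card: "1 \<le> card ?X"
    proof -
      have "(\<lambda>i\<in>{..<d}. 0) \<in> ?X" using sparse_grid_mono[OF d(1), of 0 "Suc s" N] by auto
      then show ?thesis using finite_sparse_grid card_gt_0_iff[of ?X] by force
    qed
    moreover have "ln (real (card ?X)) \<le> (A * z powr \<theta> + 2) * ln (z * (2 * (B * z powr K) + 3))"
    proof -
      have M_eq: "M = B * z powr K"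
      proof -
        have exponent: "- real (2 * Suc m) * (- 1 / \<gamma>) = K"
          by (simp only: K_def minus_mult_minus times_divide_eq_right mult_1_right minus_divide_left[symmetric])
        have "\<eta> * \<kappa>\<^sup>2 / 100 = (\<eta> * c\<^sup>2 / 100) * z powr (- real (2 * Suc m))"
        proof -
          have "\<kappa>\<^sup>2 = c\<^sup>2 / z ^ (2 * Suc m)"
            unfolding \<kappa>_def power_divide by (simp only: power_mult[symmetric] mult.commute)
          also have "\<dots> = c\<^sup>2 * z powr (- real (2 * Suc m))"
            using z powr_realpow[of z "2 * Suc m"] by (simp only: powr_minus_divide) simp
          finally show ?thesis by simp
        qed
        then have "M = ((\<eta> * c\<^sup>2 / 100) * z powr (- real (2 * Suc m))) powr (- 1 / \<gamma>)"
          by (simp only: M_def)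
        also have "\<dots> = B * (z powr (- real (2 * Suc m))) powr (- 1 / \<gamma>)"
          unfolding B_def by (rule powr_mult)
        finally show ?thesis by (simp only: powr_powr exponent)
      qed
      have s_le: "real (Suc s) \<le> A * z powr \<theta> + 2"
      proof -
        have "\<eta> * l = \<eta> / 2 * (8 * z) powr (- (1 / r))"
          using z by (simp add: l_def powr_divide powr_minus_divide)
        then have "(\<eta> * l) powr (- q) = (\<eta> / 2) powr (- q) * (8 * z) powr (- (1 / r) * - q)"
          by (simp only: powr_mult powr_powr)
        also have "- (1 / r) * - q = \<theta>" by (simp add: \<theta>_def q_def)
        also have "(\<eta> / 2) powr (- q) * (8 * z) powr \<theta> = A * z powr \<theta>"
          by (simp only: A_def powr_mult mult.assoc)
        finally have "(\<eta> * l) powr (- q) = A * z powr \<theta>" .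
        moreover have "0 \<le> (\<eta> * l) powr (- q)" by simp
        ultimately show ?thesis unfolding s_def by linarith
      qed
      have base: "real (d * (2 * N + 1)) \<le> z * (2 * (B * z powr K) + 3)"
        unfolding of_nat_mult using d z N(3) M_eq by (intro mult_mono) auto
      have "ln (real (card ?X)) \<le> ln (real ((d * (2 * N + 1)) ^ Suc s))"
        using card by (intro ln_mono of_nat_mono card_sparse_grid_le) simp
      also have "\<dots> = real (Suc s) * ln (real (d * (2 * N + 1)))"
        unfolding of_nat_power by (rule ln_realpow)
      also have "\<dots> \<le> (A * z powr \<theta> + 2) * ln (z * (2 * (B * z powr K) + 3))"
      proof (rule mult_mono[OF s_le])
        have "0 < d * (2 * N + 1)" using d(1) by simp
        then have ge1: "1 \<le> real (d * (2 * N + 1))" by linarith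
        then show "0 \<le> ln (real (d * (2 * N + 1)))" by (rule ln_ge_zero)
        show "ln (real (d * (2 * N + 1))) \<le> ln (z * (2 * (B * z powr K) + 3))"
          using base ge1 by (intro ln_mono) linarith+
        show "0 \<le> A * z powr \<theta> + 2" using pos(1) by simp
      qed
      finally show ?thesis .
    qed
    ultimately show ?thesis by blast
  qed
  with pos show ?thesis by blast
qed

text \<open>The hypothesis on \<open>r\<close> says that the exponent \<open>p / (1 - p) / r\<close> of the sampling bound is
  less than \<open>1\<close>.\<close>

theorem corollary21:
  fixes p r :: real and S :: nat
  assumes "0 < p" and "p < 1"
    and "1 \<le> S"
    and "1 < r"
    and "r > 1 / (1 / p - 1)"
  shows "weakly_tractable {S<..} (ridge_class r p S)"
proof -
  define \<theta> where "\<theta> = p / (1 - p) / r"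
  have "1 / (1 / p - 1) = p / (1 - p)" using assms(1,2) by (simp add: field_simps)
  then have "p / (1 - p) < r" using assms(5) by simp
  then have \<theta>: "0 < \<theta>" "\<theta> < 1"
    unfolding \<theta>_def using assms(1,2,4) by (auto simp only: divide_less_eq_1_pos intro!: divide_pos_pos)
  obtain A B K where ABK: "0 < A" "0 < B" "0 < K" and bound: "\<forall>z\<ge>1. \<forall>d. 0 < d \<longrightarrow> real d \<le> z \<longrightarrow>
    (\<exists>n\<ge>1. err n d (ridge_class r p S d) \<le> ereal (1 / z) \<and>
      ln (real n) \<le> (A * z powr \<theta> + 2) * ln (z * (2 * (B * z powr K) + 3)))"
    using ridge_class_sampling_bound[OF assms(1,2,4,3)] unfolding \<theta>_def by blast
  have samples: "\<exists>n\<ge>1. err n d (ridge_class r p S d) \<le> ereal \<epsilon> \<and> ln (real n) \<le>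
      (A * (1 / \<epsilon> + real d) powr \<theta> + 2) * ln ((1 / \<epsilon> + real d) * (2 * (B * (1 / \<epsilon> + real d) powr K) + 3))"
    if \<epsilon>: "0 < \<epsilon>" and d: "d \<in> {S<..}" for \<epsilon> d
  proof -
    \<comment> \<open>Aiming at the accuracy \<open>1 / z \<le> \<epsilon>\<close> makes the bound depend on \<open>z\<close> alone.\<close>
    define z where "z = 1 / \<epsilon> + real d"
    have "0 < d" using d by simp
    then have z: "1 \<le> z" "real d \<le> z" "1 / \<epsilon> \<le> z" using \<epsilon> by (auto simp: z_def add_increasing)
    from bound[rule_format, OF z(1) \<open>0 < d\<close> z(2)] obtain n where
      n: "1 \<le> n" "err n d (ridge_class r p S d) \<le> ereal (1 / z)"
      "ln (real n) \<le> (A * z powr \<theta> + 2) * ln (z * (2 * (B * z powr K) + 3))" by blast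
    have "1 / z \<le> \<epsilon>" using z \<epsilon> by (simp add: field_simps)
    then have "err n d (ridge_class r p S d) \<le> ereal \<epsilon>" using n(2) order_trans by fastforce
    with n show ?thesis unfolding z_def by blast
  qed
  let ?\<phi> = "\<lambda>(\<epsilon>, d). 1 / \<epsilon> + real d"
  let ?F = "inf (filtercomap ?\<phi> at_top) (principal ({0<..} \<times> {S<..}))"
  define R where "R = (\<lambda>z. (A * z powr \<theta> + 2) * ln (z * (2 * (B * z powr K) + 3)) / z)"
  have "(R \<longlongrightarrow> 0) at_top" unfolding R_def using ABK \<theta> by real_asymp
  moreover have "filterlim ?\<phi> at_top ?F"
    by (rule filterlim_mono[OF filterlim_filtercomap order_refl inf_le1])
  ultimately have R_lim: "((\<lambda>x. R (?\<phi> x)) \<longlongrightarrow> 0) ?F" by (rule filterlim_compose)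
  have le: "norm (ln (real (info_complexity \<epsilon> d (ridge_class r p S d))) / (1 / \<epsilon> + real d)) \<le> R (1 / \<epsilon> + real d)"
    if \<epsilon>: "0 < \<epsilon>" and d: "d \<in> {S<..}" for \<epsilon> d
  proof -
    define k where "k = info_complexity \<epsilon> d (ridge_class r p S d)"
    obtain n where n: "1 \<le> n" "err n d (ridge_class r p S d) \<le> ereal \<epsilon>" "ln (real n) \<le>
      (A * (1 / \<epsilon> + real d) powr \<theta> + 2) * ln ((1 / \<epsilon> + real d) * (2 * (B * (1 / \<epsilon> + real d) powr K) + 3))"
      using samples[OF \<epsilon> d] by blast
    have "1 \<le> k" "k \<le> n"
      unfolding k_def info_complexity_def
      using LeastI[of "\<lambda>n. 1 \<le> n \<and> err n d (ridge_class r p S d) \<le> ereal \<epsilon>" n] n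
        Least_le[of "\<lambda>n. 1 \<le> n \<and> err n d (ridge_class r p S d) \<le> ereal \<epsilon>" n] by auto
    then have "0 \<le> ln (real k)" "ln (real k) \<le> ln (real n)" by auto
    moreover have "0 \<le> 1 / \<epsilon> + real d" using \<epsilon> by simp
    ultimately show ?thesis using n(3) unfolding k_def[symmetric] R_def
      by (auto intro!: divide_right_mono)
  qed
  have "((\<lambda>(\<epsilon>, d). ln (real (info_complexity \<epsilon> d (ridge_class r p S d))) / (1 / \<epsilon> + real d)) \<longlongrightarrow> 0) ?F"
  proof (rule Lim_null_comparison[OF _ R_lim])
    show "\<forall>\<^sub>F x in ?F. norm ((\<lambda>(\<epsilon>, d). ln (real (info_complexity \<epsilon> d (ridge_class r p S d))) /
        (1 / \<epsilon> + real d)) x) \<le> R (?\<phi> x)"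
      unfolding eventually_inf_principal by (rule always_eventually) (use le in auto)
  qed
  then show ?thesis using samples unfolding weakly_tractable_def by blast
qed

end
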